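(* For each $\epsilon>0$ there exists $\delta=\delta(\epsilon)>0$ such that whenever $\beta>0$ and $\Delta\in(0,1)$ satisfy $(\beta J)\Delta^3\le\delta$, then $$\liminf_{L\to\infty}\widetilde F^{(\Delta,\alpha)}_{L,\beta}(\theta^\star)\ge\widetilde F_\alpha(\theta^\star)-\epsilon$$ for all $\theta^\star\in[0,2\pi)$ and all $\alpha\in\{1,2,3\}$ (limit along even $L$).
   Context: On $\mathbb T_L=\mathbb Z^3/(L\mathbb Z)^3$, $L$ even, let $\mathscr H_L(\boldsymbol\theta)=\frac J2\sum_{\boldsymbol r}\sum_{\gamma=1}^3(\cos(\theta_{\boldsymbol r}-\phi_\gamma)-\cos(\theta_{\boldsymbol r+\hat{\mathrm e}_\gamma}-\phi_\gamma))^2$, $\phi_1=0,\phi_2=\tfrac{2\pi}3,\phi_3=-\tfrac{2\pi}3$, $J>0$ (the 120$^\circ$-model in angle variables). For $\alpha\in\{1,2,3\}$ let $\tilde\theta^\star=2\phi_\alpha-\theta^\star$ be the reflection of $\theta^\star$ through the direction $\phi_\alpha$. Let $\widetilde\chi_{\Delta,L}$ be the indicator that $|\theta_{\boldsymbol r}-\theta^\star|<\Delta$ (mod $2\pi$) for all $\boldsymbol r$ with even $\alpha$-th coordinate and $|\theta_{\boldsymbol r}-\tilde\theta^\star|<\Delta$ for all $\boldsymbol r$ with odd $\alpha$-th coordinate, and $\widetilde F^{(\Delta,\alpha)}_{L,\beta}(\theta^\star)=-\frac12\log\frac{\beta J}{2\pi}-\frac1{L^3}\log\int_{[0,2\pi)^{\mathbb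 T_L}}e^{-\beta\mathscr H_L}\widetilde\chi_{\Delta,L}\prod d\theta_{\boldsymbol r}$. Let $q_1=\sin^2\theta^\star$, $q_2=\sin^2(\theta^\star-\tfrac{2\pi}3)$, $q_3=\sin^2(\theta^\star+\tfrac{2\pi}3)$, $E_\gamma=|1-e^{ik_\gamma}|^2$, $E^\star_\gamma=|1+e^{ik_\gamma}|^2$. For $\alpha$ with the other two indices $\beta',\gamma'$ taken cyclically (i.e. $(\alpha,\beta',\gamma')\in\{(1,2,3),(2,3,1),(3,1,2)\}$), set $q_\pm=\frac12(q_{\beta'}\pm q_{\gamma'})$ and $\Pi_\alpha(\boldsymbol k)=\begin{pmatrix}q_\alpha E_\alpha+q_+(E_{\beta'}+E_{\gamma'})& q_-(E_{\beta'}-E_{\gamma'})\\ q_-(E_{\beta'}-E_{\gamma'})& q_\alpha E^\star_\alpha+q_+(E_{\beta'}+E_{\gamma'})\end{pmatrix}$. Finally $\widetilde F_\alpha(\theta^\star)=\frac14\int_{[-\pi,\pi]^3}\frac{d\boldsymbol k}{(2\pi)^3}\log\det\Pi_\alpha(\boldsymbol k)$. *)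

theory Defs
  imports "HOL-Analysis.Analysis"
begin

text \<open>Sites of the torus T_L = Z^3/(LZ)^3 are represented by triples with
  coordinates in {0..<L}.\<close>
type_synonym site = "nat \<times> nat \<times> nat"

definition sites :: "nat \<Rightarrow> site set" where
  "sites L = {0..<L} \<times> {0..<L} \<times> {0..<L}"

fun coord :: "nat \<Rightarrow> site \<Rightarrow> nat" where
  "coord g (a, b, c) = (if g = 1 then a else if g = 2 then b else c)"

fun shift :: "nat \<Rightarrow> nat \<Rightarrow> site \<Rightarrow> site" where
  "shift L g (a, b, c) =
     (if g = 1 then ((a + 1) mod L, b, c)
      else if g = 2 then (a, (b + 1) mod L, c)
      else (a, b, (c + 1) mod L))"

definition phi :: "nat \<Rightarrow> real" where
  "phi g = (if g = 1 then 0 else if g = 2 then 2 * pi / 3 else - 2 * pi / 3)"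

definition hamiltonian :: "real \<Rightarrow> nat \<Rightarrow> (site \<Rightarrow> real) \<Rightarrow> real" where
  "hamiltonian J L \<theta> = J / 2 * (\<Sum>r\<in>sites L. \<Sum>g\<in>{1,2,3::nat}.
      (cos (\<theta> r - phi g) - cos (\<theta> (shift L g r) - phi g))\<^sup>2)"

definition close_mod :: "real \<Rightarrow> real \<Rightarrow> real \<Rightarrow> bool" where
  "close_mod D x y \<longleftrightarrow> (\<exists>k::int. \<bar>x - y - 2 * pi * of_int k\<bar> < D)"

definition chi_tilde :: "real \<Rightarrow> nat \<Rightarrow> nat \<Rightarrow> real \<Rightarrow> (site \<Rightarrow> real) \<Rightarrow> real" where
  "chi_tilde D a L ts \<theta> =
     (if (\<forall>r\<in>sites L. (even (coord a r) \<longrightarrow> close_mod D (\<theta> r) ts)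
                    \<and> (odd (coord a r) \<longrightarrow> close_mod D (\<theta> r) (2 * phi a - ts)))
      then 1 else 0)"

definition config_measure :: "nat \<Rightarrow> (site \<Rightarrow> real) measure" where
  "config_measure L = PiM (sites L) (\<lambda>_. restrict_space lborel {0..<2 * pi})"

definition F_tilde_L :: "real \<Rightarrow> real \<Rightarrow> real \<Rightarrow> nat \<Rightarrow> nat \<Rightarrow> real \<Rightarrow> real" where
  "F_tilde_L J \<beta> D a L ts =
     - 1 / 2 * ln (\<beta> * J / (2 * pi))
     - 1 / real L ^ 3 * ln (integral\<^sup>L (config_measure L)
          (\<lambda>\<theta>. exp (- \<beta> * hamiltonian J L \<theta>) * chi_tilde D a L ts \<theta>))"

definition qq :: "nat \<Rightarrow> real \<Rightarrow> real" where
  "qq g ts = (sin (ts - phi g))\<^sup>2"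

fun kcomp :: "nat \<Rightarrow> real \<times> real \<times> real \<Rightarrow> real" where
  "kcomp g (k1, k2, k3) = (if g = 1 then k1 else if g = 2 then k2 else k3)"

definition EE :: "nat \<Rightarrow> real \<times> real \<times> real \<Rightarrow> real" where
  "EE g k = (cmod (1 - cis (kcomp g k)))\<^sup>2"

definition EEs :: "nat \<Rightarrow> real \<times> real \<times> real \<Rightarrow> real" where
  "EEs g k = (cmod (1 + cis (kcomp g k)))\<^sup>2"

definition nxt1 :: "nat \<Rightarrow> nat" where
  "nxt1 a = (if a = 1 then 2 else if a = 2 then 3 else 1)"
definition nxt2 :: "nat \<Rightarrow> nat" where
  "nxt2 a = (if a = 1 then 3 else if a = 2 then 1 else 2)"

definition det_Pi :: "nat \<Rightarrow> real \<Rightarrow> real \<times> real \<times> real \<Rightarrow> real" where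
  "det_Pi a ts k =
    (let b = nxt1 a; c = nxt2 a;
         qp = (qq b ts + qq c ts) / 2; qm = (qq b ts - qq c ts) / 2;
         p11 = qq a ts * EE a k + qp * (EE b k + EE c k);
         p12 = qm * (EE b k - EE c k);
         p21 = qm * (EE b k - EE c k);
         p22 = qq a ts * EEs a k + qp * (EE b k + EE c k)
     in p11 * p22 - p12 * p21)"

definition F_tilde :: "nat \<Rightarrow> real \<Rightarrow> real" where
  "F_tilde a ts = 1 / 4 * (LINT k : {-pi..pi} \<times> {-pi..pi} \<times> {-pi..pi} | lborel.
       ln (det_Pi a ts k) / (2 * pi) ^ 3)"

end

theory Submission
  imports Defs "HOL-Probability.Distributions" "Jordan_Normal_Form.Determinant"
begin

text \<open>
  Expanding the cosines to first order around the stratified ground state turns the Hamiltonian into a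
  quadratic form plus an error of order \<open>\<Delta>\<^sup>3\<close> per site. A mass term
  \<open>\<eta> \<Sum> x\<^sub>r\<^sup>2\<close> costs only \<open>\<beta> J \<eta> \<Delta>\<^sup>2 / 2\<close> per site on the support of the indicator;
  since \<open>\<eta>\<close> may depend on \<open>\<beta>\<close> and \<open>\<Delta>\<close>, this is harmless, and it makes the form
  positive definite, so that the constraint can be dropped and the partition function is bounded by
  a Gaussian integral. Plane waves supported on one sublattice reduce its determinant to 2 by 2 blocks, each
  at least \<open>\<eta>\<^sup>2 + det \<Pi>\<^sub>\<alpha>(k)\<close>. The logarithm of the determinant per site is then bounded
  below by a Riemann sum of a continuous function, whose integral dominates that of
  \<open>log det \<Pi>\<^sub>\<alpha>\<close>.
\<close>

section \<open>Gaussian integrals\<close>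

text \<open>The reflected angles make the ground state 2-periodic along direction alpha: a shift by
  one site exchanges the two sublattices, so ordinary plane waves do not diagonalise the quadratic
  form. Half of the momenta, each with an even and an odd wave, already give a basis. In it the
  block at k is \<eta> plus a symmetric 2 by 2 matrix which becomes Pi_alpha(k) after rotating to
  the normalised sum and difference of the two waves. Two points leave no slack. Constants per site
  must be exact, since a factor greater than 1 per site would survive in the free energy; hence
  angles on the circle are turned into displacements on the line by a piecewise translation. And det
  Pi_alpha vanishes at k = 0, where its logarithm is singular, so Riemann sums of the massless
  integrand are delicate. With \<eta> > 0 fixed while L grows the integrand is continuous, and the
  massless integral enters only through a monotone comparison. No limit of vanishing \<eta> is
  taken.\<close>

lemma det_schur_complement:
  fixes A :: "nat \<Rightarrow> nat \<Rightarrow> 'a::field"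
  assumes nz: "A n n \<noteq> 0"
  shows "Determinant.det (Matrix.mat (Suc n) (Suc n) (\<lambda>(i,j). A i j)) =
    A n n * Determinant.det (Matrix.mat n n (\<lambda>(i,j). A i j - A i n * A n j / A n n))"
proof -
  let ?M = "Matrix.mat (Suc n) (Suc n) (\<lambda>(i,j). A i j)"
  let ?P = "Matrix.mat n n (\<lambda>(i,j). A i j)" and ?v = "Matrix.mat n 1 (\<lambda>(i,j). A i n)"
    and ?w = "Matrix.mat 1 n (\<lambda>(i,j). A n j)" and ?a = "Matrix.mat 1 1 (\<lambda>(i,j). A n n)"
  let ?B = "Matrix.mat n n (\<lambda>(i,j). A i j - A i n * A n j / A n n)"
  let ?z = "Matrix.mat 1 n (\<lambda>(i,j). - A n j / A n n)"
  \<comment> \<open>Right multiplication by this unipotent matrix subtracts multiples of the last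
    column from the others and so clears the last row in front of the pivot.\<close>
  let ?U = "four_block_mat (1\<^sub>m n) (0\<^sub>m n 1) ?z (1\<^sub>m 1)"
  have M: "?M = four_block_mat ?P ?v ?w ?a"
    by (rule eq_matI) (auto simp: less_Suc_eq)
  have "?M * ?U = four_block_mat (?P * 1\<^sub>m n + ?v * ?z) (?P * 0\<^sub>m n 1 + ?v * 1\<^sub>m 1)
     (?w * 1\<^sub>m n + ?a * ?z) (?w * 0\<^sub>m n 1 + ?a * 1\<^sub>m 1)"
    unfolding M by (rule mult_four_block_mat) auto
  also have "?P * 1\<^sub>m n + ?v * ?z = ?B"
    by (rule eq_matI) (auto simp: scalar_prod_def)
  also have "?w * 1\<^sub>m n + ?a * ?z = 0\<^sub>m 1 n"
    by (rule eq_matI) (use nz in \<open>auto simp: scalar_prod_def\<close>)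
  also have "?P * 0\<^sub>m n 1 + ?v * 1\<^sub>m 1 = ?v"
    by (rule eq_matI) auto
  also have "?w * 0\<^sub>m n 1 + ?a * 1\<^sub>m 1 = ?a"
    by (rule eq_matI) auto
  finally have MU: "?M * ?U = four_block_mat ?B ?v (0\<^sub>m 1 n) ?a" .
  have "Determinant.det ?M * Determinant.det ?U = Determinant.det (?M * ?U)"
    by (rule det_mult[symmetric, of _ "Suc n"]) auto
  also have "\<dots> = Determinant.det ?B * Determinant.det ?a"
    unfolding MU by (rule det_four_block_mat_lower_left_zero) auto
  also have "Determinant.det ?a = A n n"
    by (simp add: det_single)
  also have "Determinant.det ?U = 1"
    by (subst det_four_block_mat_upper_right_zero[where n = n and m = 1]) auto
  finally show ?thesis by simp
qed

text \<open>Completing the square in the last variable leaves the form of the same Schur complement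
  that appears in the determinant recursion, so that Gaussian integral and determinant can be
  reduced in step.\<close>

lemma quadratic_form_schur_complement:
  fixes A :: "nat \<Rightarrow> nat \<Rightarrow> real"
  assumes sym: "\<And>i j. A i j = A j i" and nz: "A n n \<noteq> 0"
  shows "(\<Sum>i<Suc n. \<Sum>j<Suc n. A i j * x i * x j) =
    A n n * (x n + (\<Sum>j<n. A n j * x j) / A n n)\<^sup>2 +
    (\<Sum>i<n. \<Sum>j<n. (A i j - A i n * A n j / A n n) * x i * x j)"
proof -
  define s where "s = (\<Sum>j<n. A n j * x j)"
  have s': "(\<Sum>i<n. A i n * x i) = s"
    unfolding s_def by (rule sum.cong) (auto simp: sym)
  have "(\<Sum>i<n. \<Sum>j<n. (A i n * A n j / A n n) * x i * x j) = (\<Sum>i<n. A i n * x i) * s / A n n"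
    unfolding s_def sum_product sum_divide_distrib by (intro sum.cong) auto
  then have q: "(\<Sum>i<n. \<Sum>j<n. (A i j - A i n * A n j / A n n) * x i * x j) =
      (\<Sum>i<n. \<Sum>j<n. A i j * x i * x j) - s * s / A n n"
    by (simp add: left_diff_distrib sum_subtractf s')
  have r1: "(\<Sum>i<n. A i n * x i * x n) = s * x n"
    by (simp flip: s' add: sum_distrib_right)
  have r2: "(\<Sum>j<n. A n j * x n * x j) = s * x n"
    unfolding s_def sum_distrib_right by (intro sum.cong) auto
  show ?thesis
    unfolding q using nz
    by (simp add: sum.distrib r1 r2 flip: s_def) (simp add: power2_eq_square field_simps)
qed

lemma nn_integral_gaussian_real:
  fixes c t :: real
  assumes "c > 0"
  shows "(\<integral>\<^sup>+ y. ennreal (exp (- c / 2 * (y + t)\<^sup>2)) \<partial>lborel) = ennreal (sqrt (2 * pi / c))"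
proof -
  define s where "s = 1 / sqrt c"
  have s: "s > 0" "s\<^sup>2 = 1 / c"
    using assms by (auto simp: s_def power_divide)
  have eq: "exp (- c / 2 * (y + t)\<^sup>2) = sqrt (2 * pi / c) * normal_density (- t) s y" for y
    using assms by (simp add: normal_density_def s(2) real_sqrt_divide real_sqrt_mult)
  have "(\<integral>\<^sup>+ y. ennreal (exp (- c / 2 * (y + t)\<^sup>2)) \<partial>lborel)
     = ennreal (LINT y|lborel. sqrt (2 * pi / c) * normal_density (- t) s y)"
    unfolding eq using assms s by (intro nn_integral_eq_integral) auto
  also have "\<dots> = ennreal (sqrt (2 * pi / c))"
    using s by simp
  finally show ?thesis .
qed

text \<open>Entries are given by a function on all naturals and the size is a separate argument; an
  induction can then lower the size and replace the entries without changing the type.\<close>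

definition pos_def_upto :: "nat \<Rightarrow> (nat \<Rightarrow> nat \<Rightarrow> real) \<Rightarrow> bool" where
  "pos_def_upto n A \<longleftrightarrow>
     (\<forall>x. (\<exists>i<n. x i \<noteq> 0) \<longrightarrow> 0 < (\<Sum>i<n. \<Sum>j<n. A i j * x i * x j))"

lemma pos_def_upto_diag:
  assumes "pos_def_upto (Suc n) A"
  shows "0 < A n n"
proof -
  let ?x = "\<lambda>i. if i = n then 1 else 0 :: real"
  have "0 < (\<Sum>i<Suc n. \<Sum>j<Suc n. A i j * ?x i * ?x j)"
    using assms unfolding pos_def_upto_def by (rule allE[of _ ?x]) auto
  also have "\<dots> = (\<Sum>i<Suc n. if i = n then A n n else 0)"
    by (intro sum.cong) (auto simp: if_distrib cong: if_cong)
  finally show ?thesis by simp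
qed

lemma pos_def_upto_schur_complement:
  assumes pd: "pos_def_upto (Suc n) A" and sym: "\<And>i j. A i j = A j i"
  shows "pos_def_upto n (\<lambda>i j. A i j - A i n * A n j / A n n)"
  unfolding pos_def_upto_def
proof (intro allI impI)
  fix x :: "nat \<Rightarrow> real" assume x: "\<exists>i<n. x i \<noteq> 0"
  have a: "0 < A n n" using pd by (rule pos_def_upto_diag)
  \<comment> \<open>This last coordinate annihilates the completed square, so the full form at
    \<open>y\<close> equals the Schur complement form at \<open>x\<close>.\<close>
  define y where "y = x(n := - (\<Sum>j<n. A n j * x j) / A n n)"
  have yx: "y i = x i" if "i < n" for i using that by (simp add: y_def)
  have "0 < (\<Sum>i<Suc n. \<Sum>j<Suc n. A i j * y i * y j)"
  proof -
    from x obtain i where "i < n" "x i \<noteq> 0" by blast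
    then have "i < Suc n" "y i \<noteq> 0" using yx[of i] by auto
    then show ?thesis using pd unfolding pos_def_upto_def by blast
  qed
  also have "\<dots> = A n n * (y n + (\<Sum>j<n. A n j * y j) / A n n)\<^sup>2 +
    (\<Sum>i<n. \<Sum>j<n. (A i j - A i n * A n j / A n n) * y i * y j)"
    by (rule quadratic_form_schur_complement[OF sym]) (use a in auto)
  also have "y n + (\<Sum>j<n. A n j * y j) / A n n = 0"
    by (simp add: y_def)
  finally show "0 < (\<Sum>i<n. \<Sum>j<n. (A i j - A i n * A n j / A n n) * x i * x j)"
    by (simp add: yx)
qed

interpretation lborel_product: product_sigma_finite "\<lambda>_. lborel :: real measure"
  by (intro product_sigma_finite.intro lborel.sigma_finite_measure_axioms)

text \<open>Integrating out the last variable splits off one pivot and leaves the Gaussian of the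
  Schur complement. The determinant is the product of these pivots, so its positivity belongs to the
  same induction, where it is needed to merge the square roots. The enumeration \<open>e\<close>
  separates the numerical matrix indices from the index set of the product measure, later the
  sites.\<close>

lemma nn_integral_gaussian:
  fixes A :: "nat \<Rightarrow> nat \<Rightarrow> real" and e :: "nat \<Rightarrow> 'i"
  assumes "\<And>i j. A i j = A j i" and "pos_def_upto n A" and "c > 0" and "inj_on e {..<n}"
  shows "0 < Determinant.det (Matrix.mat n n (\<lambda>(i,j). A i j)) \<and>
    (\<integral>\<^sup>+ x. ennreal (exp (- c / 2 * (\<Sum>i<n. \<Sum>j<n. A i j * x (e i) * x (e j))))
      \<partial>PiM (e ` {..<n}) (\<lambda>_. lborel)) =
    ennreal (sqrt ((2 * pi / c) ^ n / Determinant.det (Matrix.mat n n (\<lambda>(i,j). A i j))))"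
  using assms(1,2,4)
proof (induction n arbitrary: A)
  case 0
  then show ?case
    using lborel_product.nn_integral_empty[of "\<lambda>_. 1"] by simp
next
  case (Suc n)
  note sym = Suc.prems(1) and pd = Suc.prems(2)
  define B where "B i j = A i j - A i n * A n j / A n n" for i j
  have a: "0 < A n n" using pd by (rule pos_def_upto_diag)
  have pdB: "pos_def_upto n B"
    unfolding B_def using pd sym by (rule pos_def_upto_schur_complement)
  have symB: "B i j = B j i" for i j
    using sym unfolding B_def by (metis mult.commute)
  have inj: "inj_on e {..<n}" and en: "e n \<notin> e ` {..<n}"
    using Suc.prems(3) by (auto simp: lessThan_Suc inj_on_insert)
  note IH = Suc.IH[OF symB pdB inj]
  let ?d = "Determinant.det (Matrix.mat n n (\<lambda>(i,j). B i j))"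
  have det: "Determinant.det (Matrix.mat (Suc n) (Suc n) (\<lambda>(i,j). A i j)) = A n n * ?d"
    unfolding B_def using a by (intro det_schur_complement) auto
  let ?f = "\<lambda>x. ennreal (exp (- c / 2 * (\<Sum>i<Suc n. \<Sum>j<Suc n. A i j * x (e i) * x (e j))))"
  let ?g = "\<lambda>x. ennreal (exp (- c / 2 * (\<Sum>i<n. \<Sum>j<n. B i j * x (e i) * x (e j))))"
  have split: "?f (x(e n := y)) =
     ?g x * ennreal (exp (- (c * A n n) / 2 * (y + (\<Sum>j<n. A n j * x (e j)) / A n n)\<^sup>2))" for x y
  proof -
    let ?y = "\<lambda>i. (x(e n := y)) (e i)"
    have y: "e i \<noteq> e n" if "i < n" for i using that en by (metis imageI lessThan_iff)
    have "(\<Sum>i<Suc n. \<Sum>j<Suc n. A i j * ?y i * ?y j) =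
       A n n * (?y n + (\<Sum>j<n. A n j * ?y j) / A n n)\<^sup>2 +
       (\<Sum>i<n. \<Sum>j<n. B i j * ?y i * ?y j)"
      unfolding B_def by (rule quadratic_form_schur_complement[OF sym]) (use a in auto)
    also have "\<dots> = A n n * (y + (\<Sum>j<n. A n j * x (e j)) / A n n)\<^sup>2 +
       (\<Sum>i<n. \<Sum>j<n. B i j * x (e i) * x (e j))"
      by (simp add: y)
    finally have sum: "(\<Sum>i<Suc n. \<Sum>j<Suc n. A i j * ?y i * ?y j) = \<dots>" .
    have "exp (- c / 2 * (A n n * q + r)) = exp (- c / 2 * r) * exp (- (c * A n n) / 2 * q)" for q r
      by (simp add: algebra_simps flip: exp_add)
    then show ?thesis
      unfolding sum by (simp add: ennreal_mult')
  qed
  have img: "e ` {..<Suc n} = insert (e n) (e ` {..<n})"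
    by (simp add: lessThan_Suc)
  have [measurable]: "?f \<in> borel_measurable (PiM (insert (e n) (e ` {..<n})) (\<lambda>_. lborel))"
    unfolding img[symmetric] by measurable
  have "(\<integral>\<^sup>+ x. ?f x \<partial>PiM (e ` {..<Suc n}) (\<lambda>_. lborel)) =
      (\<integral>\<^sup>+ x. (\<integral>\<^sup>+ y. ?f (x(e n := y)) \<partial>lborel) \<partial>PiM (e ` {..<n}) (\<lambda>_. lborel))"
    unfolding img by (rule lborel_product.product_nn_integral_insert) (use en in auto)
  also have "\<dots> = (\<integral>\<^sup>+ x. ?g x * ennreal (sqrt (2 * pi / (c * A n n))) \<partial>PiM (e ` {..<n}) (\<lambda>_. lborel))"
  proof (rule nn_integral_cong)
    fix x :: "'i \<Rightarrow> real"
    let ?t = "(\<Sum>j<n. A n j * x (e j)) / A n n"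
    have "(\<integral>\<^sup>+ y. ?f (x(e n := y)) \<partial>lborel) =
        ?g x * (\<integral>\<^sup>+ y. ennreal (exp (- (c * A n n) / 2 * (y + ?t)\<^sup>2)) \<partial>lborel)"
      unfolding split by (rule nn_integral_cmult) measurable
    also have "(\<integral>\<^sup>+ y. ennreal (exp (- (c * A n n) / 2 * (y + ?t)\<^sup>2)) \<partial>lborel) =
        ennreal (sqrt (2 * pi / (c * A n n)))"
      using a \<open>c > 0\<close> by (intro nn_integral_gaussian_real) simp
    finally show "(\<integral>\<^sup>+ y. ?f (x(e n := y)) \<partial>lborel) =
        ?g x * ennreal (sqrt (2 * pi / (c * A n n)))" .
  qed
  also have "\<dots> = (\<integral>\<^sup>+ x. ?g x \<partial>PiM (e ` {..<n}) (\<lambda>_. lborel)) * ennreal (sqrt (2 * pi / (c * A n n)))"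
    by (rule nn_integral_multc) measurable
  also have "\<dots> = ennreal (sqrt ((2 * pi / c) ^ n / ?d)) * ennreal (sqrt (2 * pi / (c * A n n)))"
    using IH by simp
  also have "\<dots> = ennreal (sqrt ((2 * pi / c) ^ Suc n / (A n n * ?d)))"
    using a \<open>c > 0\<close> IH by (simp add: field_simps flip: ennreal_mult' real_sqrt_mult)
  finally show ?case
    unfolding det using IH a by simp
qed

section \<open>Determinants of bond forms\<close>

text \<open>Up to the scalar sqrt m the vectors \<open>V k\<close> form a unitary matrix. Leaving
  them unnormalised avoids square roots: both sides pick up the factor m^N, which cancels. The
  complex numbers occur only here, since both determinants are images of real ones.\<close>

lemma det_unitary_congruence:
  fixes A D :: "nat \<Rightarrow> nat \<Rightarrow> real" and V :: "nat \<Rightarrow> nat \<Rightarrow> complex"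
  assumes m: "m \<noteq> 0"
    and orth: "\<And>k l. k < N \<Longrightarrow> l < N \<Longrightarrow>
      (\<Sum>i<N. cnj (V k i) * V l i) = (if k = l then of_real m else 0)"
    and cong: "\<And>k l. k < N \<Longrightarrow> l < N \<Longrightarrow>
      (\<Sum>i<N. \<Sum>j<N. cnj (V k i) * of_real (A i j) * V l j) = of_real (m * D k l)"
  shows "Determinant.det (Matrix.mat N N (\<lambda>(i,j). A i j)) =
    Determinant.det (Matrix.mat N N (\<lambda>(i,j). D i j))"
proof -
  let ?H = "Matrix.mat N N (\<lambda>(k,i). cnj (V k i))" and ?W = "Matrix.mat N N (\<lambda>(i,k). V k i)"
  let ?A = "Matrix.mat N N (\<lambda>(i,j). complex_of_real (A i j))"
  let ?D = "Matrix.mat N N (\<lambda>(i,j). complex_of_real (D i j))"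
  have HW: "?H * ?W = of_real m \<cdot>\<^sub>m 1\<^sub>m N"
    by (rule eq_matI) (auto simp: scalar_prod_def orth atLeast0LessThan)
  have HAW: "?H * (?A * ?W) = of_real m \<cdot>\<^sub>m ?D"
  proof (rule eq_matI)
    fix k l assume "k < dim_row (of_real m \<cdot>\<^sub>m ?D)" "l < dim_col (of_real m \<cdot>\<^sub>m ?D)"
    then have "k < N" "l < N" by auto
    then have "(?H * (?A * ?W)) $$ (k, l) =
        (\<Sum>i<N. \<Sum>j<N. cnj (V k i) * of_real (A i j) * V l j)"
      by (simp add: scalar_prod_def atLeast0LessThan sum_distrib_left mult.assoc)
    also have "\<dots> = of_real (m * D k l)" using \<open>k < N\<close> \<open>l < N\<close> by (rule cong)
    finally show "(?H * (?A * ?W)) $$ (k, l) = (of_real m \<cdot>\<^sub>m ?D) $$ (k, l)"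
      using \<open>k < N\<close> \<open>l < N\<close> by simp
  qed auto
  have d1: "Determinant.det ?H * Determinant.det ?W = of_real m ^ N"
    by (subst det_mult[symmetric, of _ N]) (auto simp: HW)
  have "Determinant.det ?H * (Determinant.det ?A * Determinant.det ?W) =
      Determinant.det ?H * Determinant.det (?A * ?W)"
    by (subst det_mult[of ?A N]) auto
  also have "\<dots> = Determinant.det (?H * (?A * ?W))"
    by (rule det_mult[symmetric, of _ N]) auto
  also have "\<dots> = of_real m ^ N * Determinant.det ?D"
    by (simp add: HAW)
  finally have "of_real m ^ N * Determinant.det ?A = of_real m ^ N * Determinant.det ?D"
    using d1 by (metis mult.left_commute mult.commute)
  then have eq: "Determinant.det ?A = Determinant.det ?D"
    using m by simp
  have hom: "Determinant.det (Matrix.mat N N (\<lambda>(i,j). complex_of_real (B i j))) =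
      of_real (Determinant.det (Matrix.mat N N (\<lambda>(i,j). B i j)))" for B
  proof -
    have "Matrix.mat N N (\<lambda>(i,j). complex_of_real (B i j)) =
        map_mat of_real (Matrix.mat N N (\<lambda>(i,j). B i j))"
      by (rule eq_matI) auto
    then show ?thesis by (simp add: of_real_hom.hom_det)
  qed
  show ?thesis using eq unfolding hom by simp
qed

text \<open>Diagonal blocks commute, so the block formula det(PR - QQ) applies directly and no
  permutation of the basis into 2 by 2 blocks has to be carried out.\<close>

lemma det_four_diagonal_blocks:
  fixes p q r :: "nat \<Rightarrow> real"
  shows "Determinant.det (Matrix.mat (m + m) (m + m) (\<lambda>(i,j).
      if (if i < m then i else i - m) = (if j < m then j else j - m)
      then (if i < m then (if j < m then p i else q i) else (if j < m then q j else r (i - m)))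
      else 0)) = (\<Prod>i<m. p i * r i - (q i)\<^sup>2)" (is "Determinant.det ?M = _")
proof -
  let ?d = "\<lambda>f::nat \<Rightarrow> real. Matrix.mat m m (\<lambda>(i,j). if i = j then f i else 0)"
  have dd: "?d f * ?d g = ?d (\<lambda>i. f i * g i)" for f g
  proof (rule eq_matI)
    fix i j assume "i < dim_row (?d (\<lambda>i. f i * g i))" "j < dim_col (?d (\<lambda>i. f i * g i))"
    then show "(?d f * ?d g) $$ (i, j) = ?d (\<lambda>i. f i * g i) $$ (i, j)"
      by (simp add: scalar_prod_def if_distrib[of "\<lambda>x. x * _"] cong: if_cong)
  qed auto
  have comm: "?d q * ?d r = ?d r * ?d q"
    unfolding dd[of q r] dd[of r q] by (rule eq_matI) auto
  have M: "?M = four_block_mat (?d p) (?d q) (?d q) (?d r)"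
  proof (rule eq_matI)
    fix i j assume "i < dim_row (four_block_mat (?d p) (?d q) (?d q) (?d r))"
      "j < dim_col (four_block_mat (?d p) (?d q) (?d q) (?d r))"
    then show "?M $$ (i, j) = four_block_mat (?d p) (?d q) (?d q) (?d r) $$ (i, j)"
      by (cases "i < m"; cases "j < m") simp_all
  qed simp_all
  have "Determinant.det ?M = Determinant.det (?d p * ?d r - ?d q * ?d q)"
    unfolding M by (rule det_four_block_mat[where n = m, OF _ _ _ _ comm]) simp_all
  moreover have "?d p * ?d r - ?d q * ?d q = ?d (\<lambda>i. p i * r i - (q i)\<^sup>2)"
    unfolding dd[of p r] dd[of q q]
  proof (rule eq_matI)
    fix i j assume "i < dim_row (?d (\<lambda>i. p i * r i - (q i)\<^sup>2))"
      "j < dim_col (?d (\<lambda>i. p i * r i - (q i)\<^sup>2))"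
    then show "(?d (\<lambda>i. p i * r i) - ?d (\<lambda>i. q i * q i)) $$ (i, j) =
        ?d (\<lambda>i. p i * r i - (q i)\<^sup>2) $$ (i, j)"
      by (simp add: power2_eq_square)
  qed simp_all
  moreover have "Determinant.det (?d (\<lambda>i. p i * r i - (q i)\<^sup>2)) = (\<Prod>i<m. p i * r i - (q i)\<^sup>2)"
    by (subst det_upper_triangular[where n = m])
       (simp_all add: prod_list_diag_prod upper_triangular_def atLeast0LessThan)
  ultimately show ?thesis by (simp only:)
qed

text \<open>This is the symmetric matrix of the form sum over b of \<open>w b\<close> (x at
  \<open>s b\<close> + \<open>\<sigma> b\<close> x at \<open>t b\<close>)^2. Keeping the sum over
  bonds avoids computing entries, which would require cases for coinciding bonds, as happens on the
  torus with L = 2.\<close>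

definition bond_matrix ::
  "'b set \<Rightarrow> ('b \<Rightarrow> real) \<Rightarrow> ('b \<Rightarrow> 'i) \<Rightarrow> ('b \<Rightarrow> 'i) \<Rightarrow> ('b \<Rightarrow> real) \<Rightarrow> 'i \<Rightarrow> 'i \<Rightarrow> real" where
  "bond_matrix B w s t \<sigma> i j = (\<Sum>b\<in>B. w b *
     ((if i = s b then 1 else 0) + \<sigma> b * (if i = t b then 1 else 0)) *
     ((if j = s b then 1 else 0) + \<sigma> b * (if j = t b then 1 else 0)))"

lemma bond_matrix_sym: "bond_matrix B w s t \<sigma> i j = bond_matrix B w s t \<sigma> j i"
  unfolding bond_matrix_def by (intro sum.cong) auto

text \<open>Two independent vectors over an arbitrary real field serve both uses: the real quadratic
  form, with F = G, and the Hermitian congruence, with F the conjugate of a complex wave.\<close>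

lemma sum_bond_matrix:
  fixes F G :: "'i \<Rightarrow> 'a::real_field" and e :: "nat \<Rightarrow> 'i"
  assumes e: "bij_betw e {..<N} I"
    and st: "\<And>b. b \<in> B \<Longrightarrow> s b \<in> I \<and> t b \<in> I"
  shows "(\<Sum>i<N. \<Sum>j<N. F (e i) * of_real (bond_matrix B w s t \<sigma> (e i) (e j)) * G (e j)) =
    (\<Sum>b\<in>B. of_real (w b) * (F (s b) + of_real (\<sigma> b) * F (t b)) * (G (s b) + of_real (\<sigma> b) * G (t b)))"
proof -
  have fin: "finite I" using bij_betw_finite[OF e] by simp
  define c :: "'b \<Rightarrow> 'i \<Rightarrow> 'a" where
    "c b i = (if i = s b then 1 else 0) + of_real (\<sigma> b) * (if i = t b then 1 else 0)" for b i
  have lin: "(\<Sum>i<N. H (e i) * c b (e i)) = H (s b) + of_real (\<sigma> b) * H (t b)"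
    if "b \<in> B" for b and H :: "'i \<Rightarrow> 'a"
  proof -
    have "(\<Sum>i<N. H (e i) * c b (e i)) = (\<Sum>i\<in>I. H i * c b i)"
      by (rule sum.reindex_bij_betw[OF e])
    also have "\<dots> = (\<Sum>i\<in>I. (if i = s b then H i else 0) + (if i = t b then of_real (\<sigma> b) * H i else 0))"
      by (intro sum.cong) (auto simp: c_def algebra_simps)
    also have "\<dots> = H (s b) + of_real (\<sigma> b) * H (t b)"
      using fin st[OF that] by (simp add: sum.distrib)
    finally show ?thesis .
  qed
  have "(\<Sum>i<N. \<Sum>j<N. F (e i) * of_real (bond_matrix B w s t \<sigma> (e i) (e j)) * G (e j)) =
     (\<Sum>i<N. \<Sum>j<N. \<Sum>b\<in>B. of_real (w b) * ((F (e i) * c b (e i)) * (G (e j) * c b (e j))))"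
    unfolding bond_matrix_def of_real_sum sum_distrib_left sum_distrib_right
    by (intro sum.cong) (auto simp: c_def)
  also have "\<dots> = (\<Sum>i<N. \<Sum>b\<in>B. \<Sum>j<N. of_real (w b) * ((F (e i) * c b (e i)) * (G (e j) * c b (e j))))"
    by (intro sum.cong refl sum.swap)
  also have "\<dots> = (\<Sum>b\<in>B. \<Sum>i<N. \<Sum>j<N. of_real (w b) * ((F (e i) * c b (e i)) * (G (e j) * c b (e j))))"
    by (rule sum.swap)
  also have "\<dots> = (\<Sum>b\<in>B. of_real (w b) * ((\<Sum>i<N. F (e i) * c b (e i)) * (\<Sum>j<N. G (e j) * c b (e j))))"
    by (intro sum.cong refl) (simp only: sum_product, simp only: sum_distrib_left)
  also have "\<dots> = (\<Sum>b\<in>B. of_real (w b) * (F (s b) + of_real (\<sigma> b) * F (t b)) * (G (s b) + of_real (\<sigma> b) * G (t b)))"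
    by (intro sum.cong) (simp_all add: lin mult.assoc)
  finally show ?thesis .
qed

section \<open>Plane waves on the torus\<close>

lemma finite_sites [simp]: "finite (sites L)"
  by (simp add: sites_def)

lemma coord_less: "r \<in> sites L \<Longrightarrow> coord g r < L"
  by (cases r) (auto simp: sites_def)

lemma shift_in_sites: "r \<in> sites L \<Longrightarrow> shift L g r \<in> sites L"
  by (cases r) (auto simp: sites_def)

lemma coord_shift:
  assumes "g \<in> {1,2,3::nat}" "h \<in> {1,2,3::nat}"
  shows "coord h (shift L g r) = (if h = g then (coord g r + 1) mod L else coord h r)"
  using assms by (cases r) auto

lemma sites_eqI:
  assumes "\<And>g. g \<in> {1,2,3::nat} \<Longrightarrow> coord g k = coord g l"
  shows "k = l"
  using assms[of 1] assms[of 2] assms[of 3] by (cases k; cases l) auto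

lemma sum_sites_prod:
  fixes F :: "nat \<Rightarrow> nat \<Rightarrow> 'a::comm_semiring_1"
  shows "(\<Sum>r\<in>sites L. \<Prod>g\<in>{1,2,3::nat}. F g (coord g r)) = (\<Prod>g\<in>{1,2,3::nat}. \<Sum>x<L. F g x)"
proof -
  have "(\<Sum>r\<in>sites L. \<Prod>g\<in>{1,2,3::nat}. F g (coord g r)) =
      (\<Sum>x<L. \<Sum>y<L. \<Sum>z<L. F 1 x * (F 2 y * F 3 z))"
    by (simp add: sites_def sum.cartesian_product' atLeast0LessThan)
  also have "\<dots> = (\<Sum>x<L. F 1 x) * ((\<Sum>y<L. F 2 y) * (\<Sum>z<L. F 3 z))"
    unfolding sum_distrib_right unfolding sum_distrib_left ..
  finally show ?thesis by simp
qed

text \<open>The offset -pi places the momenta in the integration domain of the limiting integral.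
  The resulting waves are L-periodic because L is even.\<close>

definition momentum :: "nat \<Rightarrow> nat \<Rightarrow> real" where
  "momentum L j = - pi + 2 * pi * real j / real L"

definition plane_wave :: "nat \<Rightarrow> site \<Rightarrow> site \<Rightarrow> complex" where
  "plane_wave L k r = (\<Prod>g\<in>{1,2,3::nat}. cis (momentum L (coord g k)) ^ coord g r)"

lemma cis_momentum_power:
  assumes "even L" "L > 0"
  shows "cis (momentum L j) ^ L = 1"
proof -
  obtain n where "L = 2 * n" using assms(1) by blast
  then have "real L * momentum L j = 2 * pi * of_int (int j - int n)"
    using assms(2) by (simp add: momentum_def field_simps)
  then show ?thesis
    by (metis Complex.DeMoivre Ints_of_int cis_multiple_2pi)
qed

lemma plane_wave_shift:
  assumes "even L" "L > 0" "g \<in> {1,2,3::nat}"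
  shows "plane_wave L k (shift L g r) = cis (momentum L (coord g k)) * plane_wave L k r"
proof -
  have *: "cis (momentum L j) ^ (Suc x mod L) = cis (momentum L j) * cis (momentum L j) ^ x" for j x
  proof -
    have "cis (momentum L j) ^ Suc x = cis (momentum L j) ^ (L * (Suc x div L) + Suc x mod L)"
      by simp
    also have "\<dots> = cis (momentum L j) ^ (Suc x mod L)"
      unfolding power_add power_mult cis_momentum_power[OF assms(1,2)] by simp
    finally show ?thesis by simp
  qed
  show ?thesis
    using assms(3) unfolding plane_wave_def by (cases r) (auto simp: * simp del: power_Suc)
qed

lemma geometric_sum_root_of_unity:
  fixes z :: complex
  assumes "z ^ n = 1" "z \<noteq> 1"
  shows "(\<Sum>x<n. z ^ x) = 0"
  using assms by (simp add: geometric_sum)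

lemma cnj_cis_momentum_mult:
  "cnj (cis (momentum L i)) * cis (momentum L j) = cis (2 * pi * (real j - real i) / real L)"
  by (simp add: cis_cnj cis_mult momentum_def diff_divide_distrib right_diff_distrib)

lemma cis_2pi_frac_neq_1:
  assumes "i < (L::nat)" "j < L" "i \<noteq> j"
  shows "cis (2 * pi * (real j - real i) / real L) \<noteq> 1"
proof
  assume "cis (2 * pi * (real j - real i) / real L) = 1"
  then have "cos (2 * pi * (real j - real i) / real L) = 1"
    by (metis cis.simps(1) one_complex.simps(1))
  then obtain n :: int where "2 * pi * (real j - real i) / real L = real_of_int n * 2 * pi"
    unfolding cos_one_2pi_int by blast
  then have "2 * pi * (real j - real i) = 2 * pi * (real_of_int n * real L)"
    using assms by (simp add: field_simps)
  then have "real_of_int (int j - int i) = real_of_int (n * int L)"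
    by simp
  then have eq: "int j - int i = n * int L"
    by (simp only: of_int_eq_iff)
  have "\<bar>int j - int i\<bar> < int L" using assms by auto
  then have "\<bar>n\<bar> * int L < 1 * int L" unfolding eq by (simp add: abs_mult)
  then have "n = 0" using assms by simp
  then show False using eq assms by simp
qed

lemma cis_2pi_frac_power:
  assumes "L > 0"
  shows "cis (2 * pi * (real j - real i) / real L) ^ L = 1"
proof -
  have "real L * (2 * pi * (real j - real i) / real L) = 2 * pi * of_int (int j - int i)"
    using assms by simp
  then show ?thesis by (metis Complex.DeMoivre Ints_of_int cis_multiple_2pi)
qed

lemma sum_cis_orthogonal:
  assumes "i < (L::nat)" "j < L"
  shows "(\<Sum>x<L. cnj (cis (momentum L i)) ^ x * cis (momentum L j) ^ x) = (if i = j then of_nat L else 0)"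
proof -
  have "(\<Sum>x<L. cnj (cis (momentum L i)) ^ x * cis (momentum L j) ^ x) =
      (\<Sum>x<L. cis (2 * pi * (real j - real i) / real L) ^ x)"
    by (simp only: cnj_cis_momentum_mult flip: power_mult_distrib)
  also have "\<dots> = (if i = j then of_nat L else 0)"
  proof (cases "i = j")
    case False
    then show ?thesis
      using geometric_sum_root_of_unity[OF cis_2pi_frac_power cis_2pi_frac_neq_1, of L i j] assms
      by simp
  qed simp
  finally show ?thesis .
qed

lemma sum_parity_split:
  fixes f :: "nat \<Rightarrow> 'a::comm_monoid_add"
  shows "(\<Sum>x<2 * n. if even x = b then f x else 0) = (\<Sum>y<n. f (2 * y + (if b then 0 else 1)))"
  by (induction n) auto

text \<open>On one parity class the summand advances by z^2, an n-th root of unity. Momenta whose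
  indices differ by n agree there up to a constant sign, so orthogonality can hold only within a
  window of n consecutive indices; its start \<open>p\<close> is left free.\<close>

lemma sum_cis_orthogonal_parity:
  assumes L: "L = 2 * n" and i: "p \<le> i" "i < p + n" and j: "p \<le> j" "j < p + n"
  shows "(\<Sum>x<L. if even x = b then cnj (cis (momentum L i)) ^ x * cis (momentum L j) ^ x else 0) =
    (if i = j then of_nat n else 0)"
proof -
  define z where "z = cis (2 * pi * (real j - real i) / real L)"
  define w where "w = cis (2 * pi * (real (j - p) - real (i - p)) / real n)"
  have zw: "z\<^sup>2 = w"
  proof -
    have "real 2 * (2 * pi * (real j - real i) / real L) =
        2 * pi * (real (j - p) - real (i - p)) / real n"
      using i j L by (simp add: field_simps of_nat_diff)
    moreover have "z\<^sup>2 = cis (real 2 * (2 * pi * (real j - real i) / real L))"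
      unfolding z_def by (rule Complex.DeMoivre)
    ultimately show ?thesis unfolding w_def by (simp only:)
  qed
  have "(\<Sum>x<L. if even x = b then cnj (cis (momentum L i)) ^ x * cis (momentum L j) ^ x else 0) =
      (\<Sum>x<2 * n. if even x = b then z ^ x else 0)"
    unfolding z_def power_mult_distrib[symmetric] cnj_cis_momentum_mult
    by (intro sum.cong) (auto simp: L)
  also have "\<dots> = (\<Sum>y<n. z ^ (2 * y + (if b then 0 else 1)))"
    by (rule sum_parity_split)
  also have "\<dots> = (\<Sum>y<n. w ^ y) * z ^ (if b then 0 else 1)"
    by (simp add: power_add power_mult zw sum_distrib_right)
  also have "\<dots> = (if i = j then of_nat n else 0)"
  proof (cases "i = j")
    case True
    then show ?thesis by (simp add: w_def z_def)
  next
    case False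
    have "(\<Sum>y<n. w ^ y) = 0"
      unfolding w_def
      by (rule geometric_sum_root_of_unity[OF cis_2pi_frac_power cis_2pi_frac_neq_1]) (use i j False in auto)
    then show ?thesis using False by simp
  qed
  finally show ?thesis .
qed

lemma sum_plane_waves_parity:
  assumes L: "L = 2 * n" and a: "a \<in> {1,2,3::nat}"
    and k: "k \<in> sites L" "p \<le> coord a k" "coord a k < p + n"
    and l: "l \<in> sites L" "p \<le> coord a l" "coord a l < p + n"
  shows "(\<Sum>r\<in>sites L. if even (coord a r) = b then cnj (plane_wave L k r) * plane_wave L l r else 0) =
    (if k = l then of_nat (n * L\<^sup>2) else 0)"
proof -
  \<comment> \<open>The parity restriction concerns only coordinate \<open>a\<close>, so it can be
    absorbed into that one factor and the sum over sites still factorises.\<close>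
  define F where "F g x = (if g = a \<and> even x \<noteq> b then 0
     else cnj (cis (momentum L (coord g k))) ^ x * cis (momentum L (coord g l)) ^ x)" for g x
  have "(\<Sum>r\<in>sites L. if even (coord a r) = b then cnj (plane_wave L k r) * plane_wave L l r else 0) =
      (\<Sum>r\<in>sites L. \<Prod>g\<in>{1,2,3::nat}. F g (coord g r))"
    using a by (intro sum.cong refl) (auto simp: F_def plane_wave_def mult_ac)
  also have "\<dots> = (\<Prod>g\<in>{1,2,3::nat}. \<Sum>x<L. F g x)"
    by (rule sum_sites_prod)
  also have "\<dots> = (\<Prod>g\<in>{1,2,3::nat}. if coord g k = coord g l then of_nat (if g = a then n else L) else 0)"
  proof (intro prod.cong refl)
    fix g :: nat assume g: "g \<in> {1,2,3}"
    show "(\<Sum>x<L. F g x) = (if coord g k = coord g l then of_nat (if g = a then n else L) else 0)"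
    proof (cases "g = a")
      case True
      have "(\<Sum>x<L. F g x) = (\<Sum>x<L. if even x = b then cnj (cis (momentum L (coord a k))) ^ x *
          cis (momentum L (coord a l)) ^ x else 0)"
        using True by (intro sum.cong) (auto simp: F_def)
      then show ?thesis
        using sum_cis_orthogonal_parity[OF L k(2,3) l(2,3), of b] True by simp
    next
      case False
      then show ?thesis
        using sum_cis_orthogonal[OF coord_less[OF k(1)] coord_less[OF l(1)], of g g]
        by (simp add: F_def)
    qed
  qed
  also have "\<dots> = (if k = l then of_nat (n * L\<^sup>2) else 0)"
  proof (cases "k = l")
    case True
    then show ?thesis using a by (auto simp: power2_eq_square)
  next
    case False
    then obtain g where g: "g \<in> {1,2,3::nat}" "coord g k \<noteq> coord g l"
      using sites_eqI by blast
    then show ?thesis using False by auto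
  qed
  finally show ?thesis .
qed

lemma sum_plane_waves_by_parity:
  fixes h :: "bool \<Rightarrow> complex"
  assumes L: "L = 2 * n" and a: "a \<in> {1,2,3::nat}"
    and k: "k \<in> sites L" "p \<le> coord a k" "coord a k < p + n"
    and l: "l \<in> sites L" "p \<le> coord a l" "coord a l < p + n"
  shows "(\<Sum>r\<in>sites L. h (even (coord a r)) * (cnj (plane_wave L k r) * plane_wave L l r)) =
    (if k = l then of_nat (n * L\<^sup>2) * (h True + h False) else 0)"
proof -
  let ?w = "\<lambda>r. cnj (plane_wave L k r) * plane_wave L l r"
  have "(\<Sum>r\<in>sites L. h (even (coord a r)) * ?w r) =
     (\<Sum>r\<in>sites L. h True * (if even (coord a r) = True then ?w r else 0) +
       h False * (if even (coord a r) = False then ?w r else 0))"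
    by (intro sum.cong) auto
  also have "\<dots> = h True * (\<Sum>r\<in>sites L. if even (coord a r) = True then ?w r else 0) +
      h False * (\<Sum>r\<in>sites L. if even (coord a r) = False then ?w r else 0)"
    by (simp only: sum.distrib sum_distrib_left)
  also have "\<dots> = (if k = l then of_nat (n * L\<^sup>2) * (h True + h False) else 0)"
    unfolding sum_plane_waves_parity[OF assms] by (simp add: algebra_simps)
  finally show ?thesis .
qed

definition momentum_vec :: "nat \<Rightarrow> site \<Rightarrow> real \<times> real \<times> real" where
  "momentum_vec L k = (momentum L (coord 1 k), momentum L (coord 2 k), momentum L (coord 3 k))"

lemma kcomp_momentum_vec:
  "g \<in> {1,2,3::nat} \<Longrightarrow> kcomp g (momentum_vec L k) = momentum L (coord g k)"
  by (auto simp: momentum_vec_def)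

section \<open>The spin-wave determinant\<close>

definition sublattice_angle :: "nat \<Rightarrow> real \<Rightarrow> bool \<Rightarrow> real" where
  "sublattice_angle a ts b = (if b then ts else 2 * phi a - ts)"

text \<open>Across a bond of direction \<open>a\<close> the ground state angle is reflected at
  \<open>phi a\<close>. The linear term of the second cosine then changes sign, and the difference
  of displacements becomes a sum.\<close>

definition bond_sign :: "nat \<Rightarrow> nat \<Rightarrow> real" where
  "bond_sign a g = (if g = a then 1 else - 1)"

definition spin_wave_form :: "nat \<Rightarrow> nat \<Rightarrow> real \<Rightarrow> real \<Rightarrow> (site \<Rightarrow> real) \<Rightarrow> real" where
  "spin_wave_form a L ts \<eta> x = (\<Sum>r\<in>sites L. \<eta> * (x r)\<^sup>2 +
     (\<Sum>g\<in>{1,2,3::nat}. (sin (sublattice_angle a ts (even (coord a r)) - phi g))\<^sup>2 *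
        (x r + bond_sign a g * x (shift L g r))\<^sup>2))"

text \<open>The bonds are pairs of a site and a direction; direction 0 stands for the mass term.\<close>

definition bond_weight :: "nat \<Rightarrow> real \<Rightarrow> real \<Rightarrow> site \<times> nat \<Rightarrow> real" where
  "bond_weight a ts \<eta> = (\<lambda>(r, g). if g = 0 then \<eta>
     else (sin (sublattice_angle a ts (even (coord a r)) - phi g))\<^sup>2)"

definition bond_end :: "nat \<Rightarrow> site \<times> nat \<Rightarrow> site" where
  "bond_end L = (\<lambda>(r, g). if g = 0 then r else shift L g r)"

definition bond_coupling :: "nat \<Rightarrow> site \<times> nat \<Rightarrow> real" where
  "bond_coupling a = (\<lambda>(r, g). if g = 0 then 0 else bond_sign a g)"

definition spin_wave_matrix :: "nat \<Rightarrow> nat \<Rightarrow> real \<Rightarrow> real \<Rightarrow> site \<Rightarrow> site \<Rightarrow> real" where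
  "spin_wave_matrix a L ts \<eta> =
     bond_matrix (sites L \<times> {0,1,2,3}) (bond_weight a ts \<eta>) fst (bond_end L) (bond_coupling a)"

lemma spin_wave_matrix_form:
  assumes e: "bij_betw e {..<N::nat} (sites L)"
  shows "(\<Sum>i<N. \<Sum>j<N. spin_wave_matrix a L ts \<eta> (e i) (e j) * x (e i) * x (e j)) =
    spin_wave_form a L ts \<eta> x"
proof -
  have "(\<Sum>i<N. \<Sum>j<N. spin_wave_matrix a L ts \<eta> (e i) (e j) * x (e i) * x (e j)) =
      (\<Sum>i<N. \<Sum>j<N. x (e i) * of_real (spin_wave_matrix a L ts \<eta> (e i) (e j)) * x (e j))"
    by (intro sum.cong) auto
  also have "\<dots> = (\<Sum>b\<in>sites L \<times> {0,1,2,3}. of_real (bond_weight a ts \<eta> b) *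
      (x (fst b) + of_real (bond_coupling a b) * x (bond_end L b)) *
      (x (fst b) + of_real (bond_coupling a b) * x (bond_end L b)))"
    unfolding spin_wave_matrix_def
    by (rule sum_bond_matrix[OF e]) (auto simp: bond_end_def shift_in_sites simp del: shift.simps)
  also have "\<dots> = spin_wave_form a L ts \<eta> x"
    unfolding spin_wave_form_def sum.cartesian_product'
    by (intro sum.cong refl) (simp add: bond_weight_def bond_coupling_def bond_end_def power2_eq_square)
  finally show ?thesis .
qed

text \<open>The bond terms alone are degenerate: for even L they vanish on the configuration that
  alternates in sign along direction \<open>a\<close> and is constant in the others. Definiteness
  comes from the mass term.\<close>

lemma pos_def_spin_wave_matrix:
  assumes e: "bij_betw e {..<N} (sites L)" and "\<eta> > 0"
  shows "pos_def_upto N (\<lambda>i j. spin_wave_matrix a L ts \<eta> (e i) (e j))"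
  unfolding pos_def_upto_def
proof (intro allI impI)
  fix y :: "nat \<Rightarrow> real" assume "\<exists>i<N. y i \<noteq> 0"
  then obtain i where i: "i < N" "y i \<noteq> 0" by blast
  define x where "x r = y (the_inv_into {..<N} e r)" for r
  have xe: "x (e j) = y j" if "j < N" for j
    using that e by (simp add: x_def the_inv_into_f_f bij_betw_def)
  have "e i \<in> sites L" using i e by (auto simp: bij_betw_def)
  have "0 < \<eta> * (x (e i))\<^sup>2" using i \<open>\<eta> > 0\<close> by (simp add: xe)
  also have "\<dots> \<le> spin_wave_form a L ts \<eta> x"
  proof -
    have "\<eta> * (x (e i))\<^sup>2 \<le> (\<Sum>r\<in>sites L. \<eta> * (x r)\<^sup>2)"
      using \<open>\<eta> > 0\<close> \<open>e i \<in> sites L\<close> by (intro member_le_sum) auto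
    also have "\<dots> \<le> spin_wave_form a L ts \<eta> x"
      unfolding spin_wave_form_def by (intro sum_mono) (simp add: sum_nonneg)
    finally show ?thesis .
  qed
  also have "\<dots> = (\<Sum>i<N. \<Sum>j<N. spin_wave_matrix a L ts \<eta> (e i) (e j) * x (e i) * x (e j))"
    by (rule spin_wave_matrix_form[OF e, symmetric])
  also have "\<dots> = (\<Sum>i<N. \<Sum>j<N. spin_wave_matrix a L ts \<eta> (e i) (e j) * y i * y j)"
    by (intro sum.cong) (auto simp: xe)
  finally show "0 < (\<Sum>i<N. \<Sum>j<N. spin_wave_matrix a L ts \<eta> (e i) (e j) * y i * y j)" .
qed

definition sublattice_wave :: "nat \<Rightarrow> nat \<Rightarrow> site \<Rightarrow> bool \<Rightarrow> site \<Rightarrow> complex" where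
  "sublattice_wave a L k b r = (if even (coord a r) = b then plane_wave L k r else 0)"

text \<open>Diagonal entry of the block at momentum \<open>v\<close>, with \<open>b\<close>
  selecting the even or odd wave. Each site belongs to two bonds of direction \<open>a\<close>, both
  of weight \<open>qq a ts\<close>, which gives the term 2 \<open>qq a ts\<close>; the phases across
  these two bonds add up to the cosine in \<open>mixing_block\<close>.\<close>

definition diagonal_block :: "nat \<Rightarrow> real \<Rightarrow> real \<Rightarrow> bool \<Rightarrow> real \<times> real \<times> real \<Rightarrow> real" where
  "diagonal_block a ts \<eta> b v = \<eta> + 2 * qq a ts +
     (\<Sum>g\<in>{1,2,3::nat} - {a}. (sin (sublattice_angle a ts b - phi g))\<^sup>2 * EE g v)"

definition mixing_block :: "nat \<Rightarrow> real \<Rightarrow> real \<times> real \<times> real \<Rightarrow> real" where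
  "mixing_block a ts v = 2 * qq a ts * cos (kcomp a v)"

lemma sin_sublattice_angle_own:
  "(sin (sublattice_angle a ts b - phi a))\<^sup>2 = qq a ts"
proof -
  have "sin (2 * phi a - ts - phi a) = - sin (ts - phi a)"
    by (metis add_diff_cancel_left' diff_diff_eq2 diff_right_commute minus_diff_eq mult_2 sin_minus)
  then show ?thesis by (auto simp: sublattice_angle_def qq_def)
qed

lemma even_coord_shift_same:
  assumes "even L" "a \<in> {1,2,3::nat}"
  shows "even (coord a (shift L a r)) \<longleftrightarrow> odd (coord a r)"
  using assms by (simp add: coord_shift dvd_mod_iff)

lemma bond_sum_sublattice_waves:
  assumes L: "L = 2 * n" "n > 0" and a: "a \<in> {1,2,3::nat}"
    and k: "k \<in> sites L" "p \<le> coord a k" "coord a k < p + n"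
    and l: "l \<in> sites L" "p \<le> coord a l" "coord a l < p + n"
  shows "(\<Sum>x\<in>sites L \<times> {0,1,2,3}. of_real (bond_weight a ts \<eta> x) *
      (cnj (sublattice_wave a L k b (fst x)) +
        of_real (bond_coupling a x) * cnj (sublattice_wave a L k b (bond_end L x))) *
      (sublattice_wave a L l c (fst x) +
        of_real (bond_coupling a x) * sublattice_wave a L l c (bond_end L x))) =
    of_real (real (n * L\<^sup>2) * (if k = l then
       if b = c then diagonal_block a ts \<eta> b (momentum_vec L k) else mixing_block a ts (momentum_vec L k)
     else 0))" (is "(\<Sum>x\<in>_. ?T x) = _")
proof -
  let ?w = "\<lambda>r. cnj (plane_wave L k r) * plane_wave L l r"
  let ?z = "\<lambda>k g. cis (momentum L (coord g k))"
  have evenL: "even L" "L > 0" using L by auto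
  \<comment> \<open>\<open>h g q\<close> is the contribution of a bond of direction \<open>g\<close>
    whose base has parity \<open>q\<close>, with the plane waves divided out. For
    \<open>g = a\<close> the far end lies on the other sublattice, so each wave lives on exactly one
    end and acquires the phase \<open>?z\<close> if that is the far one. In the other directions
    both ends share the parity.\<close>
  define h where "h g q = (if g = 0 then (if q = b \<and> q = c then of_real \<eta> else 0)
     else if g = a then of_real (qq a ts) * ((if q = b then 1 else cnj (?z k a)) * (if q = c then 1 else ?z l a))
     else if q = b \<and> q = c then of_real ((sin (sublattice_angle a ts q - phi g))\<^sup>2) *
         (cnj (1 - ?z k g) * (1 - ?z l g)) else 0)" for g :: nat and q :: bool
  have T: "?T (r, g) = h g (even (coord a r)) * ?w r" if "r \<in> sites L" "g \<in> {0,1,2,3}" for r g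
  proof -
    consider "g = 0" | "g \<noteq> 0" "g = a" | "g \<noteq> 0" "g \<noteq> a" by blast
    then show ?thesis
    proof cases
      case 1
      then show ?thesis
        by (auto simp: h_def bond_weight_def bond_coupling_def sublattice_wave_def)
    next
      case 2
      then show ?thesis
        using plane_wave_shift[OF evenL, of a] even_coord_shift_same[OF evenL(1) a, of r] a
        by (auto simp: h_def bond_weight_def bond_coupling_def bond_end_def sublattice_wave_def
            bond_sign_def sin_sublattice_angle_own)
    next
      case 3
      then have g: "g \<in> {1,2,3}" using that by auto
      have "even (coord a (shift L g r)) = even (coord a r)"
        using coord_shift[OF g a, of L r] 3 by simp
      then show ?thesis
        using plane_wave_shift[OF evenL g] 3
        by (auto simp: h_def bond_weight_def bond_coupling_def bond_end_def sublattice_wave_def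
            bond_sign_def algebra_simps)
    qed
  qed
  have "(\<Sum>x\<in>sites L \<times> {0,1,2,3}. ?T x) = (\<Sum>r\<in>sites L. \<Sum>g\<in>{0,1,2,3}. ?T (r, g))"
    by (rule sum.cartesian_product')
  also have "\<dots> = (\<Sum>r\<in>sites L. \<Sum>g\<in>{0,1,2,3}. h g (even (coord a r)) * ?w r)"
    by (intro sum.cong refl) (rule T)
  also have "\<dots> = (\<Sum>g\<in>{0,1,2,3}. \<Sum>r\<in>sites L. h g (even (coord a r)) * ?w r)"
    by (rule sum.swap)
  also have "\<dots> = (\<Sum>g\<in>{0,1,2,3}. if k = l then of_nat (n * L\<^sup>2) * (h g True + h g False) else 0)"
    by (intro sum.cong refl sum_plane_waves_by_parity[OF L(1) a k l])
  also have "\<dots> = of_nat (n * L\<^sup>2) * (if k = l then \<Sum>g\<in>{0,1,2,3}. h g True + h g False else 0)"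
    by (simp add: distrib_left)
  also have "(if k = l then \<Sum>g\<in>{0,1,2,3}. h g True + h g False else 0) =
     of_real (if k = l then
       if b = c then diagonal_block a ts \<eta> b (momentum_vec L k) else mixing_block a ts (momentum_vec L k)
     else 0)"
  proof (cases "k = l")
    case kl: True
    have zz: "cnj (1 - ?z k g) * (1 - ?z k g) = of_real (EE g (momentum_vec L k))"
      if "g \<in> {1,2,3}" for g
      unfolding EE_def kcomp_momentum_vec[OF that]
      by (simp only: complex_norm_square mult.commute)
    have unit: "cnj (?z k a) * ?z k a = 1"
      by (simp add: cis_cnj cis_mult)
    have split: "(\<Sum>g\<in>{0,1,2,3}. f g) = f 0 + f a + (\<Sum>g\<in>{1,2,3} - {a}. f g)"
      for f :: "nat \<Rightarrow> complex"
    proof -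
      have "(\<Sum>g\<in>{0,1,2,3}. f g) = f 0 + (\<Sum>g\<in>{1,2,3}. f g)" by simp
      also have "(\<Sum>g\<in>{1,2,3}. f g) = f a + (\<Sum>g\<in>{1,2,3} - {a}. f g)"
        using a by (intro sum.remove) auto
      finally show ?thesis by (simp add: add.assoc)
    qed
    have a0: "a \<noteq> 0" using a by auto
    show ?thesis
    proof (cases "b = c")
      case True
      have "h g True + h g False = of_real ((sin (sublattice_angle a ts b - phi g))\<^sup>2 * EE g (momentum_vec L k))"
        if "g \<in> {1,2,3} - {a}" for g
        using that kl True zz[of g] by (cases b) (auto simp: h_def)
      then have "(\<Sum>g\<in>{1,2,3} - {a}. h g True + h g False) =
          of_real (\<Sum>g\<in>{1,2,3} - {a}. (sin (sublattice_angle a ts b - phi g))\<^sup>2 * EE g (momentum_vec L k))"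
        by simp
      moreover have "h 0 True + h 0 False = of_real \<eta>"
        using True by (cases b) (auto simp: h_def)
      moreover have "h a True + h a False = of_real (2 * qq a ts)"
        using True kl unit a0 by (cases b) (auto simp: h_def)
      ultimately show ?thesis
        unfolding split using True kl by (simp add: diagonal_block_def)
    next
      case False
      have "h g True + h g False = 0" if "g \<in> {1,2,3} - {a}" for g
        using that False by (auto simp: h_def)
      then have "(\<Sum>g\<in>{1,2,3} - {a}. h g True + h g False) = 0"
        by simp
      moreover have "h 0 True + h 0 False = 0"
        using False by (auto simp: h_def)
      moreover have "h a True + h a False = of_real (mixing_block a ts (momentum_vec L k))"
      proof -
        have "h a True + h a False = of_real (qq a ts) * (cnj (?z k a) + ?z k a)"
          using False kl a0 by (cases b; cases c) (auto simp: h_def algebra_simps)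
        also have "cnj (?z k a) + ?z k a = of_real (2 * cos (momentum L (coord a k)))"
          by (simp add: complex_eq_iff)
        finally show ?thesis
          using kcomp_momentum_vec[OF a] by (simp add: mixing_block_def)
      qed
      ultimately show ?thesis
        unfolding split using False kl by simp
    qed
  qed simp
  finally show ?thesis by simp
qed

lemma card_half_momenta:
  assumes L: "L = 2 * n" and a: "a \<in> {1,2,3::nat}" and p: "p + n \<le> L"
  shows "card {k \<in> sites L. p \<le> coord a k \<and> coord a k < p + n} = n * L\<^sup>2"
proof -
  have "card {k \<in> sites L. p \<le> coord a k \<and> coord a k < p + n} =
      (\<Sum>k\<in>sites L. if p \<le> coord a k \<and> coord a k < p + n then 1 else 0)"
    by (simp add: sum.If_cases Int_def)
  also have "\<dots> = (\<Sum>k\<in>sites L. \<Prod>g\<in>{1,2,3::nat}.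
      (\<lambda>g x. if g = a then if p \<le> x \<and> x < p + n then 1 else 0 else 1) g (coord g k))"
    using a by (intro sum.cong refl) auto
  also have "\<dots> = (\<Prod>g\<in>{1,2,3::nat}. \<Sum>x<L. if g = a then if p \<le> x \<and> x < p + n then 1 else 0 else 1)"
    by (rule sum_sites_prod)
  also have "\<dots> = (\<Prod>g\<in>{1,2,3::nat}. if g = a then n else L)"
  proof (intro prod.cong refl)
    fix g :: nat
    have "(\<Sum>x<L. if p \<le> x \<and> x < p + n then 1 else 0) = card {p..<p + n}"
    proof -
      have "{x \<in> {..<L}. p \<le> x \<and> x < p + n} = {p..<p + n}" using p by auto
      then show ?thesis by (simp add: sum.If_cases Int_def)
    qed
    then show "(\<Sum>x<L. if g = a then if p \<le> x \<and> x < p + n then 1 else 0 else 1) = (if g = a then n else L)"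
      by simp
  qed
  also have "\<dots> = n * L\<^sup>2"
    using a by (auto simp: power2_eq_square)
  finally show ?thesis .
qed

text \<open>Translations by two sites along \<open>a\<close> and by one site in the other directions
  preserve the form, so it couples only the even and the odd wave of equal momentum. A window of
  half of the momenta supplies exactly L^3 such waves, and any position of the window will
  do.\<close>

lemma det_spin_wave_matrix:
  assumes L: "L = 2 * n" "n > 0" and a: "a \<in> {1,2,3::nat}" and p: "p + n \<le> L"
    and e: "bij_betw e {..<L ^ 3} (sites L)"
  shows "Determinant.det (Matrix.mat (L ^ 3) (L ^ 3) (\<lambda>(i,j). spin_wave_matrix a L ts \<eta> (e i) (e j))) =
    (\<Prod>k\<in>{k \<in> sites L. p \<le> coord a k \<and> coord a k < p + n}.
      diagonal_block a ts \<eta> True (momentum_vec L k) * diagonal_block a ts \<eta> False (momentum_vec L k)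
        - (mixing_block a ts (momentum_vec L k))\<^sup>2)"
proof -
  let ?K = "{k \<in> sites L. p \<le> coord a k \<and> coord a k < p + n}"
  define m where "m = n * L\<^sup>2"
  have N: "L ^ 3 = m + m" unfolding m_def using L by (simp add: power2_eq_square power3_eq_cube)
  have "finite ?K" by simp
  then obtain \<kappa> where "bij_betw \<kappa> {0..<card ?K} ?K" using ex_bij_betw_nat_finite by blast
  then have \<kappa>: "bij_betw \<kappa> {..<m} ?K"
    using card_half_momenta[OF L(1) a p] by (simp add: atLeast0LessThan m_def)
  \<comment> \<open>Indices below \<open>m\<close> number the even waves, the remaining ones the odd
    waves; \<open>ix\<close> recovers the number of the momentum they share.\<close>
  define ix where "ix i = (if i < m then i else i - m)" for i
  have ix: "ix i < m" if "i < L ^ 3" for i using that N by (auto simp: ix_def)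
  have \<kappa>K: "\<kappa> (ix i) \<in> sites L" "p \<le> coord a (\<kappa> (ix i))" "coord a (\<kappa> (ix i)) < p + n"
    if "i < L ^ 3" for i using ix[OF that] \<kappa> by (auto simp: bij_betw_def)
  have \<kappa>_eq: "\<kappa> (ix i) = \<kappa> (ix j) \<longleftrightarrow> ix i = ix j" if "i < L ^ 3" "j < L ^ 3" for i j
    using ix[OF that(1)] ix[OF that(2)] \<kappa> by (auto simp: bij_betw_def inj_on_eq_iff)
  define V where "V i j = sublattice_wave a L (\<kappa> (ix i)) (i < m) (e j)" for i j
  define P where "P i = diagonal_block a ts \<eta> True (momentum_vec L (\<kappa> i))" for i
  define R where "R i = diagonal_block a ts \<eta> False (momentum_vec L (\<kappa> i))" for i
  define Q where "Q i = mixing_block a ts (momentum_vec L (\<kappa> i))" for i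
  define D where "D i j = (if ix i = ix j
      then (if i < m then (if j < m then P i else Q i) else (if j < m then Q j else R (i - m)))
      else 0)" for i j
  have "Determinant.det (Matrix.mat (L ^ 3) (L ^ 3) (\<lambda>(i,j). spin_wave_matrix a L ts \<eta> (e i) (e j))) =
      Determinant.det (Matrix.mat (L ^ 3) (L ^ 3) (\<lambda>(i,j). D i j))"
  proof (rule det_unitary_congruence[where V = V and m = "real m"])
    show "real m \<noteq> 0" using L by (simp add: m_def)
  next
    fix k l assume kl: "k < L ^ 3" "l < L ^ 3"
    let ?h = "\<lambda>q. if q = (k < m) \<and> q = (l < m) then 1 else 0 :: complex"
    have "(\<Sum>i<L ^ 3. cnj (V k i) * V l i) =
        (\<Sum>r\<in>sites L. cnj (sublattice_wave a L (\<kappa> (ix k)) (k < m) r) * sublattice_wave a L (\<kappa> (ix l)) (l < m) r)"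
      unfolding V_def by (rule sum.reindex_bij_betw[OF e])
    also have "\<dots> = (\<Sum>r\<in>sites L. ?h (even (coord a r)) *
        (cnj (plane_wave L (\<kappa> (ix k)) r) * plane_wave L (\<kappa> (ix l)) r))"
      by (intro sum.cong refl) (auto simp: sublattice_wave_def)
    also have "\<dots> = (if \<kappa> (ix k) = \<kappa> (ix l) then of_nat (n * L\<^sup>2) * (?h True + ?h False) else 0)"
      by (rule sum_plane_waves_by_parity[OF L(1) a \<kappa>K[OF kl(1)] \<kappa>K[OF kl(2)]])
    also have "\<dots> = (if k = l then of_real (real m) else 0)"
      using kl N unfolding \<kappa>_eq[OF kl] by (auto simp: ix_def m_def split: if_splits)
    finally show "(\<Sum>i<L ^ 3. cnj (V k i) * V l i) = (if k = l then of_real (real m) else 0)" .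
  next
    fix k l assume kl: "k < L ^ 3" "l < L ^ 3"
    have "(\<Sum>i<L ^ 3. \<Sum>j<L ^ 3. cnj (V k i) * of_real (spin_wave_matrix a L ts \<eta> (e i) (e j)) * V l j) =
      (\<Sum>x\<in>sites L \<times> {0,1,2,3}. of_real (bond_weight a ts \<eta> x) *
      (cnj (sublattice_wave a L (\<kappa> (ix k)) (k < m) (fst x)) +
        of_real (bond_coupling a x) * cnj (sublattice_wave a L (\<kappa> (ix k)) (k < m) (bond_end L x))) *
      (sublattice_wave a L (\<kappa> (ix l)) (l < m) (fst x) +
        of_real (bond_coupling a x) * sublattice_wave a L (\<kappa> (ix l)) (l < m) (bond_end L x)))"
      unfolding V_def spin_wave_matrix_def
      by (rule sum_bond_matrix[OF e, where F = "\<lambda>r. cnj (sublattice_wave a L (\<kappa> (ix k)) (k < m) r)"])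
         (auto simp: bond_end_def shift_in_sites simp del: shift.simps)
    also have "\<dots> = of_real (real (n * L\<^sup>2) * (if \<kappa> (ix k) = \<kappa> (ix l) then
       if (k < m) = (l < m) then diagonal_block a ts \<eta> (k < m) (momentum_vec L (\<kappa> (ix k)))
       else mixing_block a ts (momentum_vec L (\<kappa> (ix k))) else 0))"
      by (rule bond_sum_sublattice_waves[OF L a \<kappa>K[OF kl(1)] \<kappa>K[OF kl(2)]])
    also have "\<dots> = of_real (real m * D k l)"
      unfolding \<kappa>_eq[OF kl] m_def[symmetric] D_def P_def Q_def R_def
      by (cases "k < m"; cases "l < m") (auto simp: ix_def)
    finally show "(\<Sum>i<L ^ 3. \<Sum>j<L ^ 3. cnj (V k i) * of_real (spin_wave_matrix a L ts \<eta> (e i) (e j)) * V l j) =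
        of_real (real m * D k l)" .
  qed
  also have "\<dots> = (\<Prod>i<m. P i * R i - (Q i)\<^sup>2)"
    unfolding N D_def ix_def by (rule det_four_diagonal_blocks)
  also have "\<dots> = (\<Prod>k\<in>?K. diagonal_block a ts \<eta> True (momentum_vec L k) *
      diagonal_block a ts \<eta> False (momentum_vec L k) - (mixing_block a ts (momentum_vec L k))\<^sup>2)"
    unfolding P_def Q_def R_def by (rule prod.reindex_bij_betw[OF \<kappa>])
  finally show ?thesis .
qed

section \<open>Reduction to the Gaussian integral\<close>

lemma card_sites: "card (sites L) = L ^ 3"
  by (simp add: sites_def power3_eq_cube)

text \<open>The representative of x - b modulo 2 pi in the half-open interval from -pi to pi.
  Writing it with the floor function makes it total and visibly measurable.\<close>

definition centred :: "real \<Rightarrow> real \<Rightarrow> real" where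
  "centred b x = x - b - 2 * pi * of_int \<lfloor>(x - b + pi) / (2 * pi)\<rfloor>"

lemma centred_measurable [measurable]: "centred b \<in> borel_measurable borel"
  unfolding centred_def by measurable

lemma cos_centred: "cos (b + centred b x - c) = cos (x - c)"
proof -
  let ?k = "\<lfloor>(x - b + pi) / (2 * pi)\<rfloor>"
  have "b + centred b x - c = (x - c) - 2 * pi * of_int ?k"
    by (simp add: centred_def)
  moreover have "cos ((x - c) - 2 * pi * of_int ?k) = cos (x - c)"
    by (subst cos_diff) (simp add: sin_int_2pin cos_int_2pin)
  ultimately show ?thesis by (simp only:)
qed

lemma centred_close:
  assumes "close_mod D x b" "D < 1"
  shows "\<bar>centred b x\<bar> < D"
proof -
  obtain k :: int where k: "\<bar>x - b - 2 * pi * of_int k\<bar> < D"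
    using assms unfolding close_mod_def by blast
  have "\<lfloor>(x - b + pi) / (2 * pi)\<rfloor> = k"
  proof (rule floor_unique)
    show "of_int k \<le> (x - b + pi) / (2 * pi)" "(x - b + pi) / (2 * pi) < of_int k + 1"
      using k assms(2) pi_gt3 by (simp_all add: field_simps abs_less_iff)
  qed
  then show ?thesis using k by (simp add: centred_def)
qed

text \<open>On one period the map consists of two translations with disjoint images, so the change
  of variables costs no constant. This exactness matters because the estimate is applied once per
  site.\<close>

lemma nn_integral_centred_le:
  fixes g :: "real \<Rightarrow> ennreal"
  assumes [measurable]: "g \<in> borel_measurable borel"
  shows "(\<integral>\<^sup>+ y. g (centred b y) \<partial>restrict_space lborel {0..<2 * pi}) \<le> (\<integral>\<^sup>+ y. g y \<partial>lborel)"
proof -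
  \<comment> \<open>\<open>d\<close> is the representative of \<open>b\<close> with -pi < d \<le>
    pi, so the jump of \<open>centred b\<close> inside the period occurs at d + pi.\<close>
  define k where "k = \<lfloor>(pi - b) / (2 * pi)\<rfloor>"
  define d where "d = b + 2 * pi * of_int k"
  have "of_int k \<le> (pi - b) / (2 * pi)" "(pi - b) / (2 * pi) < of_int k + 1"
    unfolding k_def by linarith+
  then have d: "d \<le> pi" "- pi < d"
    unfolding d_def by (simp_all add: field_simps)
  have c1: "centred b y = y - d" if "0 \<le> y" "y < d + pi" for y
  proof -
    have "\<lfloor>(y - b + pi) / (2 * pi)\<rfloor> = k"
      by (rule floor_unique) (use that d in \<open>simp_all add: d_def field_simps\<close>)
    then show ?thesis by (simp add: centred_def d_def)
  qed
  have c2: "centred b y = y - d - 2 * pi" if "d + pi \<le> y" "y < 2 * pi" for y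
  proof -
    have "\<lfloor>(y - b + pi) / (2 * pi)\<rfloor> = k + 1"
      by (rule floor_unique) (use that d in \<open>simp_all add: d_def field_simps\<close>)
    then show ?thesis by (simp add: centred_def d_def algebra_simps)
  qed
  have "(\<integral>\<^sup>+ y. g (centred b y) \<partial>restrict_space lborel {0..<2 * pi}) =
      (\<integral>\<^sup>+ y. g (centred b y) * indicator {0..<2 * pi} y \<partial>lborel)"
    by (rule nn_integral_restrict_space) simp
  also have "\<dots> = (\<integral>\<^sup>+ y. g (y - d) * indicator {0..<d + pi} y +
      g (y - d - 2 * pi) * indicator {d + pi..<2 * pi} y \<partial>lborel)"
    using d c1 c2 by (intro nn_integral_cong) (auto simp: indicator_def)
  also have "\<dots> = (\<integral>\<^sup>+ y. g (y - d) * indicator {0..<d + pi} y \<partial>lborel) +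
      (\<integral>\<^sup>+ y. g (y - d - 2 * pi) * indicator {d + pi..<2 * pi} y \<partial>lborel)"
    by (rule nn_integral_add) measurable
  also have "(\<integral>\<^sup>+ y. g (y - d) * indicator {0..<d + pi} y \<partial>lborel) =
      (\<integral>\<^sup>+ y. g y * indicator {- d..<pi} y \<partial>lborel)"
    by (subst nn_integral_real_affine[where c = 1 and t = d])
       (auto simp: indicator_def intro!: nn_integral_cong)
  also have "(\<integral>\<^sup>+ y. g (y - d - 2 * pi) * indicator {d + pi..<2 * pi} y \<partial>lborel) =
      (\<integral>\<^sup>+ y. g y * indicator {- pi..<- d} y \<partial>lborel)"
    by (subst nn_integral_real_affine[where c = 1 and t = "d + 2 * pi"])
       (auto simp: indicator_def intro!: nn_integral_cong)
  also have "(\<integral>\<^sup>+ y. g y * indicator {- d..<pi} y \<partial>lborel) + (\<integral>\<^sup>+ y. g y * indicator {- pi..<- d} y \<partial>lborel) =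
      (\<integral>\<^sup>+ y. g y * indicator {- d..<pi} y + g y * indicator {- pi..<- d} y \<partial>lborel)"
    by (rule nn_integral_add[symmetric]) measurable
  also have "\<dots> \<le> (\<integral>\<^sup>+ y. g y \<partial>lborel)"
    by (intro nn_integral_mono) (auto simp: indicator_def)
  finally show ?thesis .
qed

abbreviation angle_measure :: "real measure" where
  "angle_measure \<equiv> restrict_space lborel {0..<2 * pi}"

lemma centred_measurable_angle [measurable]: "centred b \<in> measurable angle_measure lborel"
  by (rule measurable_restrict_space1) simp

interpretation angle: finite_measure angle_measure
  by (rule finite_measureI) (simp add: space_restrict_space emeasure_restrict_space)

interpretation angle_product: product_sigma_finite "\<lambda>_. angle_measure"
  by (intro product_sigma_finite.intro angle.sigma_finite_measure_axioms)

text \<open>The one-dimensional comparison is applied to one coordinate at a time by Tonelli. The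
  centre \<open>b r\<close> may vary with the site, as the two sublattices have different ground
  state angles.\<close>

lemma nn_integral_PiM_centred_le:
  assumes "finite I" and "G \<in> borel_measurable (PiM I (\<lambda>_. lborel))"
  shows "(\<integral>\<^sup>+ \<theta>. G (\<lambda>r\<in>I. centred (b r) (\<theta> r)) \<partial>PiM I (\<lambda>_. angle_measure)) \<le>
    (\<integral>\<^sup>+ x. G x \<partial>PiM I (\<lambda>_. lborel))"
  using assms
proof (induction I arbitrary: G rule: finite_induct)
  case empty
  then show ?case
    using lborel_product.nn_integral_empty[of G]
      angle_product.nn_integral_empty[of "\<lambda>\<theta>. G (\<lambda>r\<in>{}. centred (b r) (\<theta> r))"]
    by (simp add: restrict_def)
next
  case (insert i I)
  note [measurable] = insert.prems
  have [measurable]: "(\<lambda>\<theta>. \<lambda>r\<in>J. centred (b r) (\<theta> r)) \<in>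
      measurable (PiM J (\<lambda>_. angle_measure)) (PiM J (\<lambda>_. lborel))" for J
    by measurable
  define G' where "G' x = (\<integral>\<^sup>+ y. G (x(i := y)) \<partial>lborel)" for x
  have G'[measurable]: "G' \<in> borel_measurable (PiM I (\<lambda>_. lborel))"
    unfolding G'_def by measurable
  have "(\<integral>\<^sup>+ \<theta>. G (\<lambda>r\<in>insert i I. centred (b r) (\<theta> r)) \<partial>PiM (insert i I) (\<lambda>_. angle_measure)) =
      (\<integral>\<^sup>+ \<theta>. \<integral>\<^sup>+ y. G (\<lambda>r\<in>insert i I. centred (b r) ((\<theta>(i := y)) r)) \<partial>angle_measure \<partial>PiM I (\<lambda>_. angle_measure))"
    using insert.hyps by (intro angle_product.product_nn_integral_insert) measurable
  also have "\<dots> = (\<integral>\<^sup>+ \<theta>. \<integral>\<^sup>+ y. G ((\<lambda>r\<in>I. centred (b r) (\<theta> r))(i := centred (b i) y)) \<partial>angle_measure \<partial>PiM I (\<lambda>_. angle_measure))"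
  proof -
    have "(\<lambda>r\<in>insert i I. centred (b r) ((\<theta>(i := y)) r)) =
        (\<lambda>r\<in>I. centred (b r) (\<theta> r))(i := centred (b i) y)" for \<theta> y
      using insert.hyps by (auto simp: fun_eq_iff)
    then show ?thesis by (simp only:)
  qed
  also have "\<dots> \<le> (\<integral>\<^sup>+ \<theta>. G' (\<lambda>r\<in>I. centred (b r) (\<theta> r)) \<partial>PiM I (\<lambda>_. angle_measure))"
  proof (rule nn_integral_mono)
    fix \<theta> assume "\<theta> \<in> space (PiM I (\<lambda>_. angle_measure))"
    have "(\<lambda>r\<in>I. centred (b r) (\<theta> r)) \<in> space (PiM I (\<lambda>_. lborel))"
      by (simp add: space_PiM)
    then have "(\<lambda>y. G ((\<lambda>r\<in>I. centred (b r) (\<theta> r))(i := y))) \<in> borel_measurable borel"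
      by measurable
    then show "(\<integral>\<^sup>+ y. G ((\<lambda>r\<in>I. centred (b r) (\<theta> r))(i := centred (b i) y)) \<partial>angle_measure) \<le>
        G' (\<lambda>r\<in>I. centred (b r) (\<theta> r))"
      unfolding G'_def by (rule nn_integral_centred_le)
  qed
  also have "\<dots> \<le> (\<integral>\<^sup>+ x. G' x \<partial>PiM I (\<lambda>_. lborel))"
    by (rule insert.IH) measurable
  also have "\<dots> = (\<integral>\<^sup>+ x. G x \<partial>PiM (insert i I) (\<lambda>_. lborel))"
    unfolding G'_def using insert.hyps
    by (intro lborel_product.product_nn_integral_insert[symmetric]) measurable
  finally show ?case .
qed

section \<open>Taylor remainders and the lower bound on the energy\<close>

lemma abs_cos_minus_1_le: "\<bar>cos x - 1\<bar> \<le> x\<^sup>2 / 2" for x :: real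
proof -
  have "\<bar>sin (x / 2)\<bar> \<le> \<bar>x / 2\<bar>" by (rule abs_sin_x_le_abs_x)
  then have "\<bar>sin (x / 2)\<bar>\<^sup>2 \<le> \<bar>x / 2\<bar>\<^sup>2" by (rule power_mono) simp
  moreover have "cos x = 1 - 2 * (sin (x / 2))\<^sup>2"
    using cos_double_sin[of "x / 2"] by simp
  ultimately show ?thesis by (simp add: power_divide)
qed

lemma abs_sin_minus_self_le: "\<bar>sin x - x\<bar> \<le> \<bar>x\<bar> ^ 3 / 2" for x :: real
proof -
  have pos: "\<bar>sin y - y\<bar> \<le> \<bar>y\<bar> ^ 3 / 2" if "y > 0" for y :: real
  proof -
    obtain z where z: "0 < z" "z < y" "(sin y - y) - (sin 0 - 0) = (y - 0) * (cos z - 1)"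
    proof -
      have "((\<lambda>t. sin t - t) has_real_derivative cos t - 1) (at t)" for t :: real
        by (auto intro!: derivative_eq_intros)
      then show thesis
        using MVT2[of 0 y "\<lambda>t. sin t - t" "\<lambda>t. cos t - 1"] \<open>y > 0\<close> that by blast
    qed
    have "z\<^sup>2 \<le> y\<^sup>2" using z by (intro power_mono) auto
    then have "\<bar>cos z - 1\<bar> \<le> y\<^sup>2 / 2"
      using abs_cos_minus_1_le[of z] by linarith
    then have "\<bar>y\<bar> * \<bar>cos z - 1\<bar> \<le> \<bar>y\<bar> * (y\<^sup>2 / 2)"
      by (intro mult_left_mono) auto
    then show ?thesis using z that by (simp add: abs_mult power2_eq_square power3_eq_cube)
  qed
  consider "x > 0" | "x = 0" | "- x > 0" by linarith
  then show ?thesis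
  proof cases
    case 3
    then show ?thesis using pos[of "- x"] by (simp add: abs_minus_commute)
  qed (use pos in auto)
qed

lemma cos_linearization_error:
  fixes b x :: real
  assumes "\<bar>x\<bar> \<le> 1"
  shows "\<bar>cos (b + x) - cos b + sin b * x\<bar> \<le> x\<^sup>2"
proof -
  have "\<bar>x\<bar> ^ 3 \<le> \<bar>x\<bar> ^ 2" using assms by (intro power_decreasing) auto
  then have s: "\<bar>sin x - x\<bar> \<le> x\<^sup>2 / 2" using abs_sin_minus_self_le[of x] by simp
  have "cos (b + x) - cos b + sin b * x = cos b * (cos x - 1) - sin b * (sin x - x)"
    by (simp add: cos_add algebra_simps)
  also have "\<bar>\<dots>\<bar> \<le> \<bar>cos b\<bar> * \<bar>cos x - 1\<bar> + \<bar>sin b\<bar> * \<bar>sin x - x\<bar>"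
    using abs_triangle_ineq4[of "cos b * (cos x - 1)" "sin b * (sin x - x)"] by (simp only: abs_mult)
  also have "\<dots> \<le> 1 * (x\<^sup>2 / 2) + 1 * (x\<^sup>2 / 2)"
    using abs_cos_minus_1_le[of x] s by (intro add_mono mult_mono) auto
  finally show ?thesis by simp
qed

lemma bond_energy_lower_bound:
  fixes x y u v s D :: real
  assumes uv: "cos v = cos u" "sin v = - s * sin u" and s: "\<bar>s\<bar> = 1"
    and D: "\<bar>x\<bar> \<le> D" "\<bar>y\<bar> \<le> D" "D \<le> 1"
  shows "(sin u)\<^sup>2 * (x + s * y)\<^sup>2 - 8 * D ^ 3 \<le> (cos (u + x) - cos (v + y))\<^sup>2"
proof -
  define l where "l = - sin u * (x + s * y)"
  define e where "e = (cos (u + x) - cos u + sin u * x) - (cos (v + y) - cos v + sin v * y)"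
  have D0: "0 \<le> D" using D by linarith
  have sq: "x\<^sup>2 \<le> D\<^sup>2" "y\<^sup>2 \<le> D\<^sup>2" using D by (simp_all add: abs_le_square_iff[symmetric])
  have dec: "cos (u + x) - cos (v + y) = l + e"
    unfolding l_def e_def uv by (simp add: algebra_simps)
  have e: "\<bar>e\<bar> \<le> 2 * D\<^sup>2"
    using cos_linearization_error[of x u] cos_linearization_error[of y v] D sq
    unfolding e_def by linarith
  have "\<bar>x + s * y\<bar> \<le> \<bar>x\<bar> + \<bar>s\<bar> * \<bar>y\<bar>" by (metis abs_mult abs_triangle_ineq)
  then have "\<bar>x + s * y\<bar> \<le> 2 * D" using s D by simp
  then have "\<bar>sin u\<bar> * \<bar>x + s * y\<bar> \<le> 1 * (2 * D)" by (intro mult_mono) auto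
  then have l: "\<bar>l\<bar> \<le> 2 * D" by (simp add: l_def abs_mult)
  have "\<bar>l\<bar> * \<bar>e\<bar> \<le> 2 * D * (2 * D\<^sup>2)" using l e D0 by (intro mult_mono) auto
  then have "- (l * e) \<le> 4 * D ^ 3"
    by (simp add: abs_mult[symmetric] power2_eq_square power3_eq_cube)
  then have "l\<^sup>2 - 8 * D ^ 3 \<le> l\<^sup>2 + 2 * (l * e) + e\<^sup>2"
    using zero_le_power2[of e] by linarith
  also have "\<dots> = (l + e)\<^sup>2" by (simp add: power2_sum)
  finally show ?thesis unfolding dec by (simp add: l_def power_mult_distrib)
qed

text \<open>Each site carries three bonds with error 8D^3 each, whence 24D^3. The mass term, absent
  from the Hamiltonian, is paid for by its maximum \<open>\<eta> * D\<^sup>2\<close> on the small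
  displacements.\<close>

lemma hamiltonian_lower_bound:
  assumes J: "J > 0" and L: "even L" and a: "a \<in> {1,2,3::nat}" and D: "D \<le> 1" and \<eta>: "0 \<le> \<eta>"
    and x: "\<And>r. r \<in> sites L \<Longrightarrow> \<bar>x r\<bar> \<le> D"
    and \<theta>: "\<And>r g. r \<in> sites L \<Longrightarrow>
      cos (\<theta> r - phi g) = cos (sublattice_angle a ts (even (coord a r)) + x r - phi g)"
  shows "J / 2 * (spin_wave_form a L ts \<eta> x - (24 * D ^ 3 + \<eta> * D\<^sup>2) * real L ^ 3) \<le> hamiltonian J L \<theta>"
proof -
  let ?ang = "\<lambda>r. sublattice_angle a ts (even (coord a r))"
  let ?c = "\<lambda>r g. (cos (\<theta> r - phi g) - cos (\<theta> (shift L g r) - phi g))\<^sup>2"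
  let ?q = "\<lambda>r g. (sin (?ang r - phi g))\<^sup>2 * (x r + bond_sign a g * x (shift L g r))\<^sup>2"
  have bond: "?q r g - 8 * D ^ 3 \<le> ?c r g" if r: "r \<in> sites L" and g: "g \<in> {1,2,3}" for r g
  proof -
    let ?u = "?ang r - phi g" and ?v = "?ang (shift L g r) - phi g"
    have r': "shift L g r \<in> sites L" using r by (rule shift_in_sites)
    have uv: "cos ?v = cos ?u \<and> sin ?v = - bond_sign a g * sin ?u"
    proof (cases "g = a")
      case True
      have refl: "2 * phi a - ts - phi a = - (ts - phi a)" by simp
      show ?thesis
        using True even_coord_shift_same[OF L a, of r]
        by (auto simp: sublattice_angle_def bond_sign_def refl simp del: minus_diff_eq)
    next
      case False
      then have "coord a (shift L g r) = coord a r" using coord_shift[OF g a] by simp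
      then show ?thesis using False by (simp add: bond_sign_def)
    qed
    have "?q r g - 8 * D ^ 3 \<le> (cos (?u + x r) - cos (?v + x (shift L g r)))\<^sup>2"
      using uv x[OF r] x[OF r'] D by (intro bond_energy_lower_bound) (auto simp: bond_sign_def)
    also have "\<dots> = ?c r g"
      using \<theta>[OF r] \<theta>[OF r'] by (simp add: algebra_simps)
    finally show ?thesis .
  qed
  have site: "\<eta> * (x r)\<^sup>2 + (\<Sum>g\<in>{1,2,3}. ?q r g) - (24 * D ^ 3 + \<eta> * D\<^sup>2) \<le> (\<Sum>g\<in>{1,2,3}. ?c r g)"
    if r: "r \<in> sites L" for r
  proof -
    have "(x r)\<^sup>2 \<le> D\<^sup>2" using x[OF r] by (simp add: abs_le_square_iff[symmetric])
    then have "\<eta> * (x r)\<^sup>2 \<le> \<eta> * D\<^sup>2" using \<eta> by (rule mult_left_mono)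
    moreover have "(\<Sum>g\<in>{1,2,3::nat}. ?q r g - 8 * D ^ 3) \<le> (\<Sum>g\<in>{1,2,3}. ?c r g)"
      by (intro sum_mono bond r)
    then have "(\<Sum>g\<in>{1,2,3::nat}. ?q r g) - 24 * D ^ 3 \<le> (\<Sum>g\<in>{1,2,3}. ?c r g)"
      by (simp only: sum_subtractf) simp
    ultimately show ?thesis by linarith
  qed
  have "spin_wave_form a L ts \<eta> x - (24 * D ^ 3 + \<eta> * D\<^sup>2) * real L ^ 3 =
      (\<Sum>r\<in>sites L. \<eta> * (x r)\<^sup>2 + (\<Sum>g\<in>{1,2,3}. ?q r g) - (24 * D ^ 3 + \<eta> * D\<^sup>2))"
    unfolding spin_wave_form_def sum_subtractf by (simp add: card_sites)
  also have "\<dots> \<le> (\<Sum>r\<in>sites L. \<Sum>g\<in>{1,2,3}. ?c r g)"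
    by (intro sum_mono site)
  finally show ?thesis
    unfolding hamiltonian_def using J by (intro mult_left_mono) auto
qed

section \<open>The momentum-space integral\<close>

lemma EE_eq: "EE g k = 2 - 2 * cos (kcomp g k)"
proof -
  have "(cmod (1 - cis t))\<^sup>2 = 2 - 2 * cos t" for t
  proof -
    have "(cmod (1 - cis t))\<^sup>2 = (1 - cos t)\<^sup>2 + (sin t)\<^sup>2" by (simp add: cmod_power2)
    also have "\<dots> = 2 - 2 * cos t" by (simp add: power2_diff sin_squared_eq)
    finally show ?thesis .
  qed
  then show ?thesis by (simp add: EE_def)
qed

lemma EEs_eq: "EEs g k = 2 + 2 * cos (kcomp g k)"
proof -
  have "(cmod (1 + cis t))\<^sup>2 = 2 + 2 * cos t" for t
  proof -
    have "(cmod (1 + cis t))\<^sup>2 = (1 + cos t)\<^sup>2 + (sin t)\<^sup>2" by (simp add: cmod_power2)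
    also have "\<dots> = 2 + 2 * cos t" by (simp add: power2_sum sin_squared_eq)
    finally show ?thesis .
  qed
  then show ?thesis by (simp add: EEs_def)
qed

lemma EE_bounds: "0 \<le> EE g k" "EE g k \<le> 4"
  using cos_ge_minus_one[of "kcomp g k"] cos_le_one[of "kcomp g k"] unfolding EE_eq by linarith+

lemma qq_bounds: "0 \<le> qq g ts" "qq g ts \<le> 1"
  by (simp_all add: qq_def abs_square_le_1)

text \<open>The expansion has only nonnegative terms, on which both bounds for the determinant rest.
  The two weighted sums of \<open>EE b k\<close> and \<open>EE c k\<close> are the contributions of
  the transverse bonds on the even and the odd sublattice.\<close>

lemma det_Pi_eq:
  fixes a :: nat
  defines "b \<equiv> nxt1 a" and "c \<equiv> nxt2 a"
  shows "det_Pi a ts k = 4 * (qq a ts)\<^sup>2 * (sin (kcomp a k))\<^sup>2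
    + 2 * qq a ts * ((qq b ts * EE b k + qq c ts * EE c k) + (qq c ts * EE b k + qq b ts * EE c k))
    + (qq b ts * EE b k + qq c ts * EE c k) * (qq c ts * EE b k + qq b ts * EE c k)"
proof -
  have "EE a k * EEs a k = 4 * (sin (kcomp a k))\<^sup>2"
    unfolding EE_eq EEs_eq sin_squared_eq by (simp add: algebra_simps power2_eq_square)
  moreover have "EE a k + EEs a k = 4" by (simp add: EE_eq EEs_eq)
  moreover have "(x * EE a k + y) * (x * EEs a k + y) =
      x\<^sup>2 * (EE a k * EEs a k) + x * y * (EE a k + EEs a k) + y\<^sup>2" for x y
    by (simp add: algebra_simps power2_eq_square)
  ultimately have *: "(x * EE a k + y) * (x * EEs a k + y) =
      4 * x\<^sup>2 * (sin (kcomp a k))\<^sup>2 + 4 * x * y + y\<^sup>2" for x y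
    by simp
  have **: "4 * x * ((p + q) / 2 * (B + C)) + ((p + q) / 2 * (B + C))\<^sup>2 -
      (p - q) / 2 * (B - C) * ((p - q) / 2 * (B - C)) =
      2 * x * ((p * B + q * C) + (q * B + p * C)) + (p * B + q * C) * (q * B + p * C)" for x p q B C :: real
    by (simp add: field_simps power2_eq_square)
  show ?thesis
    unfolding det_Pi_def Let_def b_def[symmetric] c_def[symmetric] *
    using **[of "qq a ts" "qq b ts" "qq c ts" "EE b k" "EE c k"] by linarith
qed

lemma cos_sin_2pi_3: "cos (2 * pi / 3) = - 1 / 2" "sin (2 * pi / 3) = sqrt 3 / 2"
proof -
  have eq: "2 * pi / 3 = pi - pi / 3" by simp
  show "cos (2 * pi / 3) = - 1 / 2" unfolding eq cos_pi_minus cos_60 by simp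
  show "sin (2 * pi / 3) = sqrt 3 / 2" unfolding eq sin_pi_minus sin_60 by simp
qed

lemma qq_sum: "qq 1 ts + qq 2 ts + qq 3 ts = 3 / 2"
proof -
  have "(s * (- 1 / 2) - c * (r / 2))\<^sup>2 + (s * (- 1 / 2) + c * (r / 2))\<^sup>2 =
      s\<^sup>2 / 2 + r\<^sup>2 / 2 * c\<^sup>2" for s c r :: real
    by (simp add: power2_eq_square field_simps)
  from this[of _ _ "sqrt 3"] have id: "(s * (- 1 / 2) - c * (sqrt 3 / 2))\<^sup>2 + (s * (- 1 / 2) + c * (sqrt 3 / 2))\<^sup>2 =
      s\<^sup>2 / 2 + 3 / 2 * c\<^sup>2" for s c :: real
    by simp
  have "qq 1 ts = (sin ts)\<^sup>2"
    by (simp add: qq_def phi_def)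
  moreover have "qq 2 ts = (sin ts * (- 1 / 2) - cos ts * (sqrt 3 / 2))\<^sup>2"
  proof -
    have "ts - phi 2 = ts - 2 * pi / 3" by (simp add: phi_def)
    then show ?thesis unfolding qq_def by (simp only: sin_diff cos_sin_2pi_3)
  qed
  moreover have "qq 3 ts = (sin ts * (- 1 / 2) + cos ts * (sqrt 3 / 2))\<^sup>2"
  proof -
    have "ts - phi 3 = ts + 2 * pi / 3" by (simp add: phi_def)
    then show ?thesis unfolding qq_def by (simp only: sin_add cos_sin_2pi_3)
  qed
  ultimately show ?thesis
    using id[of "sin ts" "cos ts"] sin_squared_eq[of ts] by linarith
qed

text \<open>The three weights sum to 3/2 and each is at most 1, so the other two sum to at least 1/2
  and their squares to at least 1/8, uniformly in \<open>ts\<close>. The bound is a product of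
  functions of single coordinates, so its logarithm splits into one-dimensional
  singularities.\<close>

lemma det_Pi_lower_bound:
  assumes a: "a \<in> {1,2,3::nat}"
  shows "EE (nxt1 a) k * EE (nxt2 a) k / 8 \<le> det_Pi a ts k"
proof -
  define B C x y where "B = EE (nxt1 a) k" "C = EE (nxt2 a) k" "x = qq (nxt1 a) ts" "y = qq (nxt2 a) ts"
  note defs = this
  have pos: "0 \<le> B" "0 \<le> C" "0 \<le> x" "0 \<le> y" "0 \<le> qq a ts"
    by (simp_all add: defs EE_bounds qq_bounds)
  have "1 / 2 \<le> x + y"
    using a qq_sum[of ts] qq_bounds(2)[of a ts] by (auto simp: defs nxt1_def nxt2_def)
  then have "(1 / 2)\<^sup>2 \<le> (x + y)\<^sup>2" by (rule power_mono) simp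
  then have "1 / 8 \<le> x\<^sup>2 + y\<^sup>2"
    using sum_squares_bound[of x y] by (simp add: power2_sum power_divide)
  then have "B * C * (1 / 8) \<le> B * C * (x\<^sup>2 + y\<^sup>2)"
    using pos by (intro mult_left_mono) auto
  also have "\<dots> \<le> B * C * (x\<^sup>2 + y\<^sup>2) + x * y * (B\<^sup>2 + C\<^sup>2)"
    using pos by simp
  also have "\<dots> = (x * B + y * C) * (y * B + x * C)"
    by (simp add: algebra_simps power2_eq_square)
  also have "\<dots> \<le> det_Pi a ts k"
    using pos unfolding det_Pi_eq by (simp add: defs[symmetric])
  finally show ?thesis by (simp add: defs)
qed

text \<open>The three terms of the expansion are at most 4, 32 and 64.\<close>

lemma det_Pi_upper_bound: "det_Pi a ts k \<le> 100"
proof -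
  have le4: "qq g ts * EE h k \<le> 4" "0 \<le> qq g ts * EE h k" for g h
  proof -
    have "qq g ts * EE h k \<le> 1 * 4" by (intro mult_mono qq_bounds EE_bounds) auto
    then show "qq g ts * EE h k \<le> 4" by simp
  qed (simp add: EE_bounds qq_bounds)
  let ?u = "qq (nxt1 a) ts * EE (nxt1 a) k + qq (nxt2 a) ts * EE (nxt2 a) k"
  let ?v = "qq (nxt2 a) ts * EE (nxt1 a) k + qq (nxt1 a) ts * EE (nxt2 a) k"
  have uv: "0 \<le> ?u" "?u \<le> 8" "0 \<le> ?v" "?v \<le> 8"
    using le4[of "nxt1 a" "nxt1 a"] le4[of "nxt2 a" "nxt2 a"] le4[of "nxt1 a" "nxt2 a"] le4[of "nxt2 a" "nxt1 a"]
    by linarith+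
  have "(qq a ts)\<^sup>2 * (sin (kcomp a k))\<^sup>2 \<le> 1 * 1"
    using qq_bounds[of a ts] by (intro mult_mono) (auto simp: abs_square_le_1)
  moreover have "qq a ts * (?u + ?v) \<le> 1 * 16"
    using uv qq_bounds[of a ts] by (intro mult_mono) auto
  moreover have "?u * ?v \<le> 8 * 8"
    using uv by (intro mult_mono) auto
  ultimately show ?thesis unfolding det_Pi_eq by linarith
qed

lemma continuous_on_kcomp [continuous_intros]: "continuous_on A (kcomp g)"
proof -
  consider "kcomp g = (\<lambda>k. fst k)" | "kcomp g = (\<lambda>k. fst (snd k))" | "kcomp g = (\<lambda>k. snd (snd k))"
    by (cases "g = 1"; cases "g = 2") (auto simp: fun_eq_iff)
  then show ?thesis by cases (auto intro!: continuous_intros)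
qed

lemma continuous_on_det_Pi: "continuous_on A (det_Pi a ts)"
  unfolding det_Pi_eq EE_eq by (intro continuous_intros)

lemma kcomp_measurable [measurable]: "kcomp g \<in> borel_measurable borel"
  by (intro borel_measurable_continuous_onI continuous_intros)

lemma det_Pi_measurable [measurable]: "det_Pi a ts \<in> borel_measurable borel"
  by (intro borel_measurable_continuous_onI continuous_on_det_Pi)

section \<open>Integrability of the logarithmic singularity\<close>

lemma AE_kcomp_neq: "AE k in lborel. kcomp g k \<noteq> c"
proof -
  have c: "{c} \<in> null_sets (lborel :: real measure)" by (simp add: null_sets_def)
  have n2: "{c} \<times> UNIV \<in> null_sets (lborel :: (real \<times> real) measure)"
      "UNIV \<times> {c} \<in> null_sets (lborel :: (real \<times> real) measure)"
    using lborel.times_in_null_sets1[OF c, of UNIV] lborel.times_in_null_sets2[OF _ c, of UNIV lborel]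
    by (simp_all add: lborel_prod)
  have n3: "{c} \<times> UNIV \<in> null_sets (lborel :: (real \<times> real \<times> real) measure)"
    using lborel.times_in_null_sets1[OF c, of UNIV] by (simp add: lborel_prod)
  have n4: "UNIV \<times> S \<in> null_sets (lborel :: (real \<times> real \<times> real) measure)"
    if "S \<in> null_sets lborel" for S :: "(real \<times> real) set"
    using lborel.times_in_null_sets2[OF _ that, of UNIV lborel] by (simp add: lborel_prod)
  consider "g = 1" | "g = 2" | "g \<noteq> 1" "g \<noteq> 2" by blast
  then show ?thesis
  proof cases
    case 1
    then show ?thesis by (intro AE_I'[OF n3]) auto
  next
    case 2
    then show ?thesis by (intro AE_I'[OF n4[OF n2(1)]]) auto
  next
    case 3
    then show ?thesis by (intro AE_I'[OF n4[OF n2(2)]]) auto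
  qed
qed

text \<open>The quartic Taylor bound gives t^2 - t^4/12, and pi^2 < 10.8 makes the subtracted term
  at most 0.9 t^2.\<close>

lemma two_minus_two_cos_ge:
  fixes t :: real
  assumes "\<bar>t\<bar> \<le> pi"
  shows "t\<^sup>2 / 10 \<le> 2 - 2 * cos t"
proof -
  obtain s where s: "cos t = (\<Sum>m<4. cos_coeff m * t ^ m) + (cos (s + 1/2 * real 4 * pi) / fact 4) * t ^ 4"
    using Maclaurin_cos_expansion[of t 4] by blast
  have "(\<Sum>m<4. cos_coeff m * t ^ m) = 1 - t\<^sup>2 / 2"
  proof -
    have "{..<4::nat} = {0,1,2,3}" by auto
    then show ?thesis by (simp add: cos_coeff_def)
  qed
  moreover have "cos (s + 1/2 * real 4 * pi) / fact 4 * t ^ 4 \<le> 1 / 24 * t ^ 4"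
    by (intro mult_right_mono) (auto simp: fact_numeral)
  ultimately have c: "cos t \<le> 1 - t\<^sup>2 / 2 + t ^ 4 / 24" using s by linarith
  have "\<bar>t\<bar> \<le> 3.2" using assms pi_approx by simp
  then have "\<bar>t\<bar>\<^sup>2 \<le> 3.2\<^sup>2" by (rule power_mono) simp
  then have "t\<^sup>2 \<le> 10.8" by (simp add: power2_eq_square)
  then have "t\<^sup>2 * t\<^sup>2 \<le> 10.8 * t\<^sup>2" by (rule mult_right_mono) simp
  then have "t ^ 4 \<le> 10.8 * t\<^sup>2" by (simp add: power4_eq_xxxx power2_eq_square mult.assoc)
  then show ?thesis using c by simp
qed

text \<open>The singular part is -2 ln |t| = 4 ln (|t|^(-1/2)), and ln y \<le> y bounds it by an
  integrable power. At t = 0 the default value ln 0 = 0 keeps the claim true.\<close>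

lemma abs_ln_two_minus_two_cos_le:
  fixes t :: real
  assumes "\<bar>t\<bar> \<le> pi"
  shows "\<bar>ln (2 - 2 * cos t)\<bar> \<le> ln 10 + 4 * \<bar>t\<bar> powr (- 1 / 2)"
proof (cases "t = 0")
  case False
  let ?E = "2 - 2 * cos t"
  have pos: "0 < t\<^sup>2 / 10" using False by simp
  have E: "t\<^sup>2 / 10 \<le> ?E" using assms by (rule two_minus_two_cos_ge)
  have "ln ?E \<le> ln 10" using pos E cos_ge_minus_one[of t] by (subst ln_le_cancel_iff) linarith+
  moreover have "- ln ?E \<le> ln 10 + 4 * \<bar>t\<bar> powr (- 1 / 2)"
  proof -
    have "ln (t\<^sup>2 / 10) \<le> ln ?E" using pos E by (subst ln_le_cancel_iff) linarith+
    moreover have "ln (t\<^sup>2 / 10) = 2 * ln \<bar>t\<bar> - ln 10"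
    proof -
      have "ln (t\<^sup>2 / 10) = ln (t\<^sup>2) - ln 10" using False by (simp add: ln_div)
      also have "ln (t\<^sup>2) = ln (\<bar>t\<bar> ^ 2)" by simp
      also have "\<dots> = 2 * ln \<bar>t\<bar>" using ln_realpow[of "\<bar>t\<bar>" 2] False by (simp del: power2_abs)
      finally show ?thesis .
    qed
    moreover have "- ln \<bar>t\<bar> / 2 = ln (\<bar>t\<bar> powr (- 1 / 2))"
      using False by (simp add: ln_powr)
    moreover have "ln (\<bar>t\<bar> powr (- 1 / 2)) \<le> \<bar>t\<bar> powr (- 1 / 2)"
      using False ln_bound[of "\<bar>t\<bar> powr (- 1 / 2)"] by simp
    ultimately show ?thesis by linarith
  qed
  ultimately show ?thesis by (simp add: abs_le_iff add_increasing2)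
qed simp

lemma integrable_inverse_sqrt: "integrable lborel (\<lambda>t::real. indicator {-pi..pi} t * \<bar>t\<bar> powr (- 1 / 2))"
proof -
  let ?f = "\<lambda>t::real. indicator {0..pi} t * t powr (- 1 / 2)"
  have "(\<lambda>t::real. t powr (- 1 / 2)) absolutely_integrable_on {0..pi}"
    by (intro nonnegative_absolutely_integrable_1 integrable_on_powr_from_0) auto
  then have "integrable lebesgue ?f" by (simp add: set_integrable_def)
  then have f: "integrable lborel ?f" by (subst (asm) integrable_completion) auto
  have "integrable lborel (\<lambda>t. ?f (0 + (- 1) * t))"
    by (rule lborel_integrable_real_affine[OF f]) simp
  then have "integrable lborel (\<lambda>t. ?f t + ?f (0 + (- 1) * t))"
    using f by (rule Bochner_Integration.integrable_add[rotated])
  moreover have "?f t + ?f (0 + (- 1) * t) = indicator {-pi..pi} t * \<bar>t\<bar> powr (- 1 / 2)" for t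
    by (auto simp: indicator_def)
  ultimately show ?thesis by (simp only:)
qed

lemma integrable_ln_two_minus_two_cos:
  "integrable lborel (\<lambda>t::real. indicator {-pi..pi} t * ln (2 - 2 * cos t))"
proof (rule Bochner_Integration.integrable_bound)
  show "integrable lborel (\<lambda>t::real. ln 10 * indicator {-pi..pi} t +
      4 * (indicator {-pi..pi} t * \<bar>t\<bar> powr (- 1 / 2)))"
    by (intro Bochner_Integration.integrable_add integrable_mult_right integrable_inverse_sqrt) simp
  show "AE t in lborel. norm (indicator {-pi..pi} t * ln (2 - 2 * cos t)) \<le>
      norm (ln 10 * indicator {-pi..pi} t + 4 * (indicator {-pi..pi} t * \<bar>t\<bar> powr (- 1 / 2)))"
  proof (rule AE_I2)
    fix t :: real
    show "norm (indicator {-pi..pi} t * ln (2 - 2 * cos t)) \<le>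
      norm (ln 10 * indicator {-pi..pi} t + 4 * (indicator {-pi..pi} t * \<bar>t\<bar> powr (- 1 / 2)))"
      using abs_ln_two_minus_two_cos_le[of t] by (cases "t \<in> {-pi..pi}") auto
  qed
qed measurable

lemma integrable_mult_pair:
  fixes f :: "'a::euclidean_space \<Rightarrow> real" and g :: "'b::euclidean_space \<Rightarrow> real"
  assumes f: "integrable lborel f" and g: "integrable lborel g"
  shows "integrable lborel (\<lambda>z. f (fst z) * g (snd z))"
proof -
  have [measurable]: "f \<in> borel_measurable lborel" "g \<in> borel_measurable lborel"
    using f g by auto
  have "integrable (lborel \<Otimes>\<^sub>M lborel) (\<lambda>z. f (fst z) * g (snd z))"
  proof (rule lborel_pair.Fubini_integrable)
    show "integrable lborel (\<lambda>x. \<integral>y. norm (f (fst (x, y)) * g (snd (x, y))) \<partial>lborel)"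
      using f by (simp add: abs_mult)
    show "AE x in lborel. integrable lborel (\<lambda>y. f (fst (x, y)) * g (snd (x, y)))"
      using g by simp
  qed measurable
  then show ?thesis by (simp add: lborel_prod)
qed

definition cube :: "(real \<times> real \<times> real) set" where
  "cube = {-pi..pi} \<times> {-pi..pi} \<times> {-pi..pi}"

lemma cube_measurable [measurable]: "cube \<in> sets borel"
  unfolding cube_def by (intro borel_Times) auto

lemma integrable_kcomp_cube:
  fixes f :: "real \<Rightarrow> real"
  assumes f: "integrable lborel (\<lambda>t. indicator {-pi..pi} t * f t)"
  shows "integrable lborel (\<lambda>k. indicator cube k * f (kcomp g k))"
proof -
  let ?I = "\<lambda>t. indicator {-pi..pi} t :: real"
  let ?h = "\<lambda>h t. ?I t * (if h = (if g = 1 then 1 else if g = 2 then 2 else 3::nat) then f t else 1)"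
  have h: "integrable lborel (?h h)" for h
    using f by (cases "h = (if g = 1 then 1 else if g = 2 then 2 else 3::nat)") simp_all
  have "integrable lborel (\<lambda>k. ?h 1 (fst k) * (\<lambda>z. ?h 2 (fst z) * ?h 3 (snd z)) (snd k))"
    by (intro integrable_mult_pair h)
  moreover have "?h 1 (fst k) * (\<lambda>z. ?h 2 (fst z) * ?h 3 (snd z)) (snd k) = indicator cube k * f (kcomp g k)" for k
    by (cases k) (auto simp: cube_def indicator_def)
  ultimately show ?thesis by (simp only:)
qed

text \<open>The sandwich between \<open>EE b k * EE c k / 8\<close> and 100 reduces integrability to
  single coordinates. Without integrability the integral would be 0 by default and its comparison
  with the massive one void. Positivity almost everywhere is recorded as well, because the default
  value ln 0 = 0 can exceed a negative ln (\<eta>^2).\<close>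

lemma integrable_ln_det_Pi:
  assumes a: "a \<in> {1,2,3::nat}"
  shows "integrable lborel (\<lambda>k. indicator cube k * ln (det_Pi a ts k))"
    and "AE k in lborel. 0 < det_Pi a ts k \<or> k \<notin> cube"
proof -
  let ?e = "\<lambda>g k. indicator cube k * ln (2 - 2 * cos (kcomp g k))"
  let ?b = "nxt1 a" and ?c = "nxt2 a"
  have pos: "0 < EE g k" if "k \<in> cube" "kcomp g k \<noteq> 0" for g k
  proof -
    have "\<bar>kcomp g k\<bar> \<le> pi" using that(1) by (cases k) (auto simp: cube_def)
    moreover have "0 < (kcomp g k)\<^sup>2 / 10" using that(2) by simp
    ultimately show ?thesis
      unfolding EE_eq using two_minus_two_cos_ge less_le_trans by blast
  qed
  show "AE k in lborel. 0 < det_Pi a ts k \<or> k \<notin> cube"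
    using AE_kcomp_neq[of ?b 0] AE_kcomp_neq[of ?c 0]
  proof eventually_elim
    case (elim k)
    show ?case
    proof (cases "k \<in> cube")
      case True
      then have "0 < EE ?b k * EE ?c k / 8" using pos[of k] elim by simp
      then show ?thesis using det_Pi_lower_bound[OF a, of k ts] by linarith
    qed simp
  qed
  show "integrable lborel (\<lambda>k. indicator cube k * ln (det_Pi a ts k))"
  proof (rule Bochner_Integration.integrable_bound)
    show "integrable lborel (\<lambda>k. ln 100 * (indicator cube k * (\<lambda>t. 1) (kcomp 1 k)) + \<bar>?e ?b k\<bar> + \<bar>?e ?c k\<bar>)"
      by (intro Bochner_Integration.integrable_add integrable_mult_right integrable_abs
          integrable_kcomp_cube integrable_ln_two_minus_two_cos) simp
    show "AE k in lborel. norm (indicator cube k * ln (det_Pi a ts k)) \<le>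
        norm (ln 100 * (indicator cube k * (\<lambda>t. 1) (kcomp 1 k)) + \<bar>?e ?b k\<bar> + \<bar>?e ?c k\<bar>)"
      using AE_kcomp_neq[of ?b 0] AE_kcomp_neq[of ?c 0]
    proof eventually_elim
      case (elim k)
      show ?case
      proof (cases "k \<in> cube")
        case True
        have p: "0 < EE ?b k" "0 < EE ?c k" using True elim pos by auto
        then have q: "0 < EE ?b k * EE ?c k / 8" by simp
        then have d: "0 < det_Pi a ts k" using det_Pi_lower_bound[OF a, of k ts] by linarith
        have "ln (det_Pi a ts k) \<le> ln 100"
          using d det_Pi_upper_bound[of a ts k] by (subst ln_le_cancel_iff) auto
        moreover have "ln (EE ?b k * EE ?c k / 8) \<le> ln (det_Pi a ts k)"
          using q d det_Pi_lower_bound[OF a, of k ts] by (subst ln_le_cancel_iff) auto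
        moreover have "ln (EE ?b k * EE ?c k / 8) = ln (EE ?b k) + ln (EE ?c k) - ln 8"
          using p by (simp add: ln_div ln_mult)
        moreover have "ln 8 \<le> ln (100::real)" by (subst ln_le_cancel_iff) auto
        ultimately have "\<bar>ln (det_Pi a ts k)\<bar> \<le> ln 100 + \<bar>ln (EE ?b k)\<bar> + \<bar>ln (EE ?c k)\<bar>"
          by linarith
        then show ?thesis using True by (simp add: EE_eq)
      qed simp
    qed
  qed measurable
qed

section \<open>Riemann sums over the momenta of the finite torus\<close>

definition momentum_cell :: "nat \<Rightarrow> site \<Rightarrow> (real \<times> real \<times> real) set" where
  "momentum_cell L j = {momentum L (coord 1 j)..<momentum L (Suc (coord 1 j))} \<times>
     {momentum L (coord 2 j)..<momentum L (Suc (coord 2 j))} \<times>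
     {momentum L (coord 3 j)..<momentum L (Suc (coord 3 j))}"

lemma momentum_Suc: "momentum L (Suc j) = momentum L j + 2 * pi / real L"
  by (simp add: momentum_def add_divide_distrib algebra_simps)

lemma momentum_bounds:
  assumes "j < L"
  shows "- pi \<le> momentum L j" "momentum L j \<le> pi" "momentum L (Suc j) \<le> pi"
proof -
  have "momentum L i \<le> pi" if "i \<le> L" for i
    using that assms by (simp add: momentum_def field_simps)
  then show "momentum L j \<le> pi" "momentum L (Suc j) \<le> pi" using assms by auto
  show "- pi \<le> momentum L j" by (simp add: momentum_def)
qed

lemma measure_momentum_cell:
  assumes "L > 0"
  shows "momentum_cell L j \<in> sets borel" "emeasure lborel (momentum_cell L j) = ennreal ((2 * pi / real L) ^ 3)"
proof -
  let ?I = "\<lambda>g. {momentum L (coord g j)..<momentum L (Suc (coord g j))}"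
  show "momentum_cell L j \<in> sets borel"
    unfolding momentum_cell_def by (intro borel_Times) auto
  have I: "emeasure lborel (?I g) = ennreal (2 * pi / real L)" for g
    by (simp add: momentum_Suc)
  have "emeasure lborel (?I 2 \<times> ?I 3) = ennreal ((2 * pi / real L) * (2 * pi / real L))"
    using lborel.emeasure_pair_measure_Times[of "?I 2" lborel "?I 3"]
    by (simp add: lborel_prod I flip: ennreal_mult')
  then have "emeasure lborel (?I 1 \<times> (?I 2 \<times> ?I 3)) = ennreal ((2 * pi / real L) * ((2 * pi / real L) * (2 * pi / real L)))"
    using lborel.emeasure_pair_measure_Times[of "?I 1" lborel "?I 2 \<times> ?I 3"]
    by (simp add: lborel_prod I borel_Times flip: ennreal_mult')
  then show "emeasure lborel (momentum_cell L j) = ennreal ((2 * pi / real L) ^ 3)"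
    by (simp add: momentum_cell_def power3_eq_cube mult.assoc)
qed

lemma momentum_cell_subset_cube:
  assumes "j \<in> sites L"
  shows "momentum_cell L j \<subseteq> cube"
proof -
  have "{momentum L (coord g j)..<momentum L (Suc (coord g j))} \<subseteq> {-pi..pi}" for g
    using momentum_bounds[OF coord_less[OF assms, of g]] by auto
  then show ?thesis unfolding momentum_cell_def cube_def by (intro Sigma_mono)
qed

lemma momentum_vec_in_cube: "j \<in> sites L \<Longrightarrow> momentum_vec L j \<in> cube"
  using momentum_bounds[OF coord_less[of j L]]
  unfolding momentum_vec_def cube_def by auto

text \<open>Half-open cells tile the cube except for its upper faces, where some coordinate equals
  pi; these form a null set.\<close>

lemma momentum_cell_unique:
  assumes L: "L > 0" and k: "k \<in> cube" and ne: "\<And>g. g \<in> {1,2,3::nat} \<Longrightarrow> kcomp g k \<noteq> pi"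
  shows "\<exists>j\<in>sites L. \<forall>i. k \<in> momentum_cell L i \<longleftrightarrow> i = j"
proof -
  define ix where "ix t = nat \<lfloor>(t + pi) * real L / (2 * pi)\<rfloor>" for t
  have ix: "ix t < L" "(momentum L i \<le> t \<and> t < momentum L (Suc i)) \<longleftrightarrow> i = ix t"
    if "- pi \<le> t" "t < pi" for t i
  proof -
    let ?s = "(t + pi) * real L / (2 * pi)"
    have s: "0 \<le> ?s" "?s < real L"
    proof -
      show "0 \<le> ?s" using that by (intro divide_nonneg_nonneg mult_nonneg_nonneg) auto
      have "(t + pi) * real L < (2 * pi) * real L" using that L by (intro mult_strict_right_mono) auto
      then show "?s < real L" by (simp add: pos_divide_less_eq mult.commute)
    qed
    show "ix t < L" using s unfolding ix_def by (simp add: nat_less_iff floor_less_iff)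
    have "(momentum L i \<le> t \<and> t < momentum L (Suc i)) \<longleftrightarrow> (real i \<le> ?s \<and> ?s < real i + 1)"
      using L by (simp add: momentum_def field_simps)
    also have "\<dots> \<longleftrightarrow> \<lfloor>?s\<rfloor> = int i"
      by (simp add: floor_eq_iff)
    also have "\<dots> \<longleftrightarrow> i = ix t" unfolding ix_def using s by auto
    finally show "(momentum L i \<le> t \<and> t < momentum L (Suc i)) \<longleftrightarrow> i = ix t" .
  qed
  obtain x y z where xyz: "k = (x, y, z)" by (cases k)
  have b: "- pi \<le> x" "x < pi" "- pi \<le> y" "y < pi" "- pi \<le> z" "z < pi"
    using k ne[of 1] ne[of 2] ne[of 3] by (auto simp: cube_def xyz)
  have "k \<in> momentum_cell L i \<longleftrightarrow> i = (ix x, ix y, ix z)" for i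
    using ix(2)[OF b(1,2), of "coord 1 i"] ix(2)[OF b(3,4), of "coord 2 i"] ix(2)[OF b(5,6), of "coord 3 i"]
    by (cases i) (auto simp: momentum_cell_def xyz)
  moreover have "(ix x, ix y, ix z) \<in> sites L"
    using ix(1) b by (simp add: sites_def)
  ultimately show ?thesis by blast
qed

text \<open>The Euclidean distance is estimated by the sum of the three coordinate distances, each
  at most the side length 2 pi / L.\<close>

lemma dist_momentum_cell:
  assumes "k \<in> momentum_cell L j"
  shows "dist k (momentum_vec L j) \<le> 6 * pi / real L"
proof -
  obtain x y z where xyz: "k = (x, y, z)" by (cases k)
  have pair: "dist (p, q) (p', q') \<le> dist p p' + dist q q'"
    for p p' :: "'p::metric_space" and q q' :: "'q::metric_space"
    unfolding dist_prod_def by (simp add: sqrt_sum_squares_le_sum)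
  have "dist x (momentum L (coord 1 j)) \<le> 2 * pi / real L" "dist y (momentum L (coord 2 j)) \<le> 2 * pi / real L"
    "dist z (momentum L (coord 3 j)) \<le> 2 * pi / real L"
    using assms by (auto simp: xyz momentum_cell_def momentum_Suc dist_real_def)
  then show ?thesis
    unfolding xyz momentum_vec_def
    using pair[of x "(y, z)" "momentum L (coord 1 j)" "(momentum L (coord 2 j), momentum L (coord 3 j))"]
      pair[of y z "momentum L (coord 2 j)" "momentum L (coord 3 j)"]
    by simp
qed

lemma compact_cube: "compact cube"
  unfolding cube_def by (intro compact_Times) auto

lemma integrable_continuous_cube:
  fixes f :: "real \<times> real \<times> real \<Rightarrow> real"
  assumes "continuous_on UNIV f"
  shows "integrable lborel (\<lambda>k. indicator cube k * f k)"
  using borel_integrable_compact[OF compact_cube continuous_on_subset[OF assms]] by simp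

text \<open>By uniform continuity the step function with value f at the lower corner plus
  \<open>e\<close> dominates f on each small cell. Only this one-sided comparison is required, as
  the free energy is bounded from below.\<close>

lemma integral_cube_le_riemann_sum:
  fixes f :: "real \<times> real \<times> real \<Rightarrow> real"
  assumes f: "continuous_on UNIV f" and e: "e > 0"
  shows "\<forall>\<^sub>F L in sequentially. (LINT k|lborel. indicator cube k * f k) \<le>
    (2 * pi) ^ 3 * ((\<Sum>j\<in>sites L. f (momentum_vec L j)) / real L ^ 3 + e)"
proof -
  have "uniformly_continuous_on cube f"
    using compact_cube continuous_on_subset[OF f] by (intro compact_uniformly_continuous) auto
  then obtain d where d: "d > 0" "\<And>x y. x \<in> cube \<Longrightarrow> y \<in> cube \<Longrightarrow> dist y x < d \<Longrightarrow> dist (f y) (f x) < e"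
    unfolding uniformly_continuous_on_def using e by metis
  obtain L0 :: nat where L0: "6 * pi / d < real L0" using reals_Archimedean2 by blast
  show ?thesis
  proof (rule eventually_sequentiallyI[of "Suc L0"])
    fix L assume "Suc L0 \<le> L"
    then have L: "L > 0" "6 * pi / d < real L" using L0 by auto
    then have small: "6 * pi / real L < d" using d(1) by (simp add: field_simps)
    let ?c = "\<lambda>j. f (momentum_vec L j) + e"
    have "(LINT k|lborel. indicator cube k * f k) \<le>
        (LINT k|lborel. (\<Sum>j\<in>sites L. ?c j * indicator (momentum_cell L j) k))"
    proof (rule integral_mono_AE)
      show "integrable lborel (\<lambda>k. indicator cube k * f k)"
        using f by (rule integrable_continuous_cube)
      show "integrable lborel (\<lambda>k. \<Sum>j\<in>sites L. ?c j * indicator (momentum_cell L j) k)"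
        using measure_momentum_cell[OF L(1)] by (intro Bochner_Integration.integrable_sum) auto
      show "AE k in lborel. indicator cube k * f k \<le> (\<Sum>j\<in>sites L. ?c j * indicator (momentum_cell L j) k)"
        using AE_kcomp_neq[of 1 pi] AE_kcomp_neq[of 2 pi] AE_kcomp_neq[of 3 pi]
      proof eventually_elim
        case (elim k)
        show ?case
        proof (cases "k \<in> cube")
          case True
          have "\<And>g. g \<in> {1,2,3::nat} \<Longrightarrow> kcomp g k \<noteq> pi" using elim by auto
          from momentum_cell_unique[OF L(1) True this]
          obtain j where j: "j \<in> sites L" "\<And>i. k \<in> momentum_cell L i \<longleftrightarrow> i = j" by blast
          have "dist k (momentum_vec L j) < d"
            using dist_momentum_cell[of k L j] j(2)[of j] small by simp
          then have "dist (f k) (f (momentum_vec L j)) < e"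
            using d(2) momentum_vec_in_cube[OF j(1)] True by blast
          then have "f k \<le> ?c j" by (simp add: dist_real_def)
          also have "?c j = (\<Sum>i\<in>sites L. if i = j then ?c i else 0)" using j(1) by simp
          also have "\<dots> = (\<Sum>i\<in>sites L. ?c i * indicator (momentum_cell L i) k)"
            by (intro sum.cong) (auto simp: indicator_def j(2))
          finally show ?thesis using True by simp
        next
          case False
          then have "indicator (momentum_cell L i) k = (0::real)" if "i \<in> sites L" for i
            using momentum_cell_subset_cube[OF that] by (auto simp: indicator_def)
          then show ?thesis using False by simp
        qed
      qed
    qed
    also have "\<dots> = (\<Sum>j\<in>sites L. ?c j * (2 * pi / real L) ^ 3)"
      using measure_momentum_cell[OF L(1)]
      by (subst Bochner_Integration.integral_sum) (auto simp: measure_def)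
    also have "\<dots> = (\<Sum>j\<in>sites L. ?c j) * (2 * pi / real L) ^ 3"
      by (rule sum_distrib_right[symmetric])
    also have "(\<Sum>j\<in>sites L. ?c j) = (\<Sum>j\<in>sites L. f (momentum_vec L j)) + real L ^ 3 * e"
      by (simp add: sum.distrib sites_def power3_eq_cube)
    also have "\<dots> * (2 * pi / real L) ^ 3 = (2 * pi) ^ 3 * ((\<Sum>j\<in>sites L. f (momentum_vec L j)) / real L ^ 3 + e)"
      using L(1) by (simp add: power_divide field_simps)
    finally show "(LINT k|lborel. indicator cube k * f k) \<le>
      (2 * pi) ^ 3 * ((\<Sum>j\<in>sites L. f (momentum_vec L j)) / real L ^ 3 + e)" .
  qed
qed

text \<open>Adding \<eta>^2 inside the logarithm only increases it, and makes it continuous on the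
  whole cube including the zeros of the determinant. The volume (2 pi)^3 of the cube cancels the
  normalisation of the integral.\<close>

lemma F_tilde_le_riemann_sum:
  assumes a: "a \<in> {1,2,3::nat}" and \<eta>: "\<eta> > 0" and e: "e > 0"
  shows "\<forall>\<^sub>F L in sequentially. F_tilde a ts \<le>
    (\<Sum>k\<in>sites L. ln (\<eta>\<^sup>2 + det_Pi a ts (momentum_vec L k))) / (4 * real L ^ 3) + e"
proof -
  let ?f = "\<lambda>k. ln (\<eta>\<^sup>2 + det_Pi a ts k)"
  have nonneg: "0 \<le> det_Pi a ts k" for k
  proof -
    have "0 \<le> EE (nxt1 a) k * EE (nxt2 a) k / 8" by (simp add: EE_bounds)
    then show ?thesis using det_Pi_lower_bound[OF a, of k ts] by linarith
  qed
  have pos: "0 < \<eta>\<^sup>2 + det_Pi a ts k" for k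
    using \<eta> nonneg[of k] by (simp add: add_pos_nonneg)
  have cont: "continuous_on UNIV ?f"
    using pos by (intro continuous_intros continuous_on_det_Pi) (metis less_irrefl)
  have "F_tilde a ts = 1 / 4 * (LINT k|lborel. indicator cube k * ln (det_Pi a ts k)) / (2 * pi) ^ 3"
    unfolding F_tilde_def set_lebesgue_integral_def cube_def[symmetric] by simp
  also have "\<dots> \<le> 1 / 4 * (LINT k|lborel. indicator cube k * ?f k) / (2 * pi) ^ 3"
  proof -
    have "(LINT k|lborel. indicator cube k * ln (det_Pi a ts k)) \<le> (LINT k|lborel. indicator cube k * ?f k)"
    proof (rule integral_mono_AE[OF integrable_ln_det_Pi(1)[OF a] integrable_continuous_cube[OF cont]])
      show "AE k in lborel. indicator cube k * ln (det_Pi a ts k) \<le> indicator cube k * ?f k"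
        using integrable_ln_det_Pi(2)[OF a, of ts]
      proof eventually_elim
        case (elim k)
        then show ?case
          using \<eta> pos[of k] by (cases "k \<in> cube") simp_all
      qed
    qed
    then show ?thesis by (intro divide_right_mono mult_left_mono) auto
  qed
  finally have F: "F_tilde a ts \<le> 1 / 4 * (LINT k|lborel. indicator cube k * ?f k) / (2 * pi) ^ 3" .
  show ?thesis
    using integral_cube_le_riemann_sum[OF cont e]
  proof eventually_elim
    case (elim L)
    let ?S = "\<Sum>k\<in>sites L. ?f (momentum_vec L k)"
    have "1 / 4 * (LINT k|lborel. indicator cube k * ?f k) / (2 * pi) ^ 3 \<le>
        1 / 4 * ((2 * pi) ^ 3 * (?S / real L ^ 3 + e)) / (2 * pi) ^ 3"
      using elim by (intro divide_right_mono mult_left_mono) auto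
    also have "\<dots> = ?S / (4 * real L ^ 3) + e / 4" by (simp add: field_simps)
    finally show ?case using F e by linarith
  qed
qed

section \<open>The free energy bound\<close>

text \<open>The reflection through direction \<open>a\<close> exchanges the other two directions
  modulo 2 pi. Hence the odd sublattice sees their weights interchanged.\<close>

lemma sin_sublattice_angle_swap:
  assumes a: "a \<in> {1,2,3::nat}"
  shows "(sin (sublattice_angle a ts False - phi (nxt1 a)))\<^sup>2 = qq (nxt2 a) ts"
    and "(sin (sublattice_angle a ts False - phi (nxt2 a)))\<^sup>2 = qq (nxt1 a) ts"
proof -
  have "(sin (2 * phi a - ts - phi g))\<^sup>2 = qq h ts"
    if gh: "2 * phi a - phi g = phi h + 2 * pi * of_int m" for g h and m :: int
  proof -
    have "2 * phi a - ts - phi g = 2 * pi * of_int m - (ts - phi h)"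
      using gh by simp
    then have "sin (2 * phi a - ts - phi g) = - sin (ts - phi h)"
      by (simp only: sin_diff[of "2 * pi * of_int m"] sin_int_2pin cos_int_2pin)
    then show ?thesis by (simp add: qq_def)
  qed
  note * = this
  have "\<exists>m::int. 2 * phi a - phi (nxt1 a) = phi (nxt2 a) + 2 * pi * of_int m"
  proof -
    consider "a = 1" | "a = 2" | "a = 3" using a by auto
    then show ?thesis
    proof cases
      case 1
      then show ?thesis by (intro exI[of _ 0]) (simp add: phi_def nxt1_def nxt2_def)
    next
      case 2
      then show ?thesis by (intro exI[of _ 1]) (simp add: phi_def nxt1_def nxt2_def)
    next
      case 3
      then show ?thesis by (intro exI[of _ "- 1"]) (simp add: phi_def nxt1_def nxt2_def)
    qed
  qed
  then obtain m :: int where m: "2 * phi a - phi (nxt1 a) = phi (nxt2 a) + 2 * pi * of_int m" by blast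
  show "(sin (sublattice_angle a ts False - phi (nxt1 a)))\<^sup>2 = qq (nxt2 a) ts"
    using *[OF m] by (simp add: sublattice_angle_def)
  have "2 * phi a - phi (nxt2 a) = phi (nxt1 a) + 2 * pi * of_int m" using m by simp
  from *[OF this] show "(sin (sublattice_angle a ts False - phi (nxt2 a)))\<^sup>2 = qq (nxt1 a) ts"
    by (simp add: sublattice_angle_def)
qed

text \<open>The block is \<eta> + Pi_alpha(k) in another orthonormal basis, so its determinant is
  \<eta>^2 + \<eta> tr Pi_alpha + det Pi_alpha. The trace, here 4q + u + w, is nonnegative and its
  term is dropped.\<close>

lemma block_determinant_lower_bound:
  assumes a: "a \<in> {1,2,3::nat}" and \<eta>: "0 \<le> \<eta>"
  shows "\<eta>\<^sup>2 + det_Pi a ts v \<le>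
    diagonal_block a ts \<eta> True v * diagonal_block a ts \<eta> False v - (mixing_block a ts v)\<^sup>2"
proof -
  let ?b = "nxt1 a" and ?c = "nxt2 a"
  define q u w where "q = qq a ts"
    and "u = qq ?b ts * EE ?b v + qq ?c ts * EE ?c v" and "w = qq ?c ts * EE ?b v + qq ?b ts * EE ?c v"
  have nonneg: "0 \<le> q" "0 \<le> u" "0 \<le> w"
    by (simp_all add: q_def u_def w_def qq_bounds EE_bounds)
  have others: "{1,2,3} - {a} = {?b, ?c}" "?b \<noteq> ?c"
    using a by (auto simp: nxt1_def nxt2_def)
  have T: "diagonal_block a ts \<eta> True v = \<eta> + 2 * q + u"
    unfolding diagonal_block_def others(1) using others(2)
    by (simp add: sublattice_angle_def q_def u_def qq_def)
  have F: "diagonal_block a ts \<eta> False v = \<eta> + 2 * q + w"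
    unfolding diagonal_block_def others(1) using others(2) sin_sublattice_angle_swap[OF a]
    by (simp add: q_def w_def)
  have "diagonal_block a ts \<eta> True v * diagonal_block a ts \<eta> False v - (mixing_block a ts v)\<^sup>2 =
      \<eta>\<^sup>2 + \<eta> * (4 * q + u + w) + (4 * q\<^sup>2 * (1 - (cos (kcomp a v))\<^sup>2) + 2 * q * (u + w) + u * w)"
    unfolding T F mixing_block_def q_def[symmetric] by (simp add: algebra_simps power2_eq_square)
  also have "4 * q\<^sup>2 * (1 - (cos (kcomp a v))\<^sup>2) + 2 * q * (u + w) + u * w = det_Pi a ts v"
    unfolding det_Pi_eq by (simp add: q_def u_def w_def sin_squared_eq)
  finally show ?thesis using \<eta> nonneg by simp
qed

text \<open>Either half of the momenta yields the whole determinant; adding both versions gives the sum over all momenta.\<close>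

lemma ln_det_spin_wave_matrix_ge:
  assumes L: "L = 2 * n" "n > 0" and a: "a \<in> {1,2,3::nat}" and \<eta>: "\<eta> > 0"
    and e: "bij_betw e {..<L ^ 3} (sites L)"
  shows "(\<Sum>k\<in>sites L. ln (\<eta>\<^sup>2 + det_Pi a ts (momentum_vec L k))) \<le>
    2 * ln (Determinant.det (Matrix.mat (L ^ 3) (L ^ 3) (\<lambda>(i,j). spin_wave_matrix a L ts \<eta> (e i) (e j))))"
    (is "_ \<le> 2 * ln ?det")
proof -
  let ?K = "\<lambda>p. {k \<in> sites L. p \<le> coord a k \<and> coord a k < p + n}"
  let ?f = "\<lambda>k. \<eta>\<^sup>2 + det_Pi a ts (momentum_vec L k)"
  have pos: "0 < ?f k" for k
  proof -
    have "0 \<le> EE (nxt1 a) v * EE (nxt2 a) v / 8" for v by (simp add: EE_bounds)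
    then have "0 \<le> det_Pi a ts (momentum_vec L k)"
      using det_Pi_lower_bound[OF a] order_trans by blast
    then show ?thesis using \<eta> by (simp add: add_pos_nonneg)
  qed
  have half: "(\<Sum>k\<in>?K p. ln (?f k)) \<le> ln ?det" if p: "p + n \<le> L" for p
  proof -
    have "(\<Sum>k\<in>?K p. ln (?f k)) = ln (\<Prod>k\<in>?K p. ?f k)"
      using pos by (intro ln_prod[symmetric]) (simp_all add: less_imp_neq[symmetric])
    also have "\<dots> \<le> ln ?det"
    proof -
      have "(\<Prod>k\<in>?K p. ?f k) \<le> ?det"
        unfolding det_spin_wave_matrix[OF L a p e]
        using pos \<eta> by (intro prod_mono conjI block_determinant_lower_bound[OF a]) (simp_all add: less_imp_le)
      moreover have "0 < (\<Prod>k\<in>?K p. ?f k)" using pos by (intro prod_pos)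
      ultimately show ?thesis using ln_le_cancel_iff less_le_trans by blast
    qed
    finally show ?thesis .
  qed
  have "sites L = ?K 0 \<union> ?K n"
  proof (intro equalityI subsetI)
    fix k assume k: "k \<in> sites L"
    then show "k \<in> ?K 0 \<union> ?K n"
      using coord_less[OF k, of a] L by (cases "coord a k < n") simp_all
  qed blast
  then have "(\<Sum>k\<in>sites L. ln (?f k)) = (\<Sum>k\<in>?K 0 \<union> ?K n. ln (?f k))" by simp
  also have "\<dots> = (\<Sum>k\<in>?K 0. ln (?f k)) + (\<Sum>k\<in>?K n. ln (?f k))"
    by (rule sum.union_disjoint) auto
  also have "\<dots> \<le> 2 * ln ?det"
    using half[of 0] half[of n] L by simp
  finally show ?thesis .
qed

section \<open>Bounds on the partition function\<close>

lemma config_component_measurable [measurable]: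
  assumes "r \<in> sites L"
  shows "(\<lambda>\<theta>. \<theta> r) \<in> borel_measurable (config_measure L)"
proof -
  have "(\<lambda>\<theta>. \<theta> r) \<in> measurable (config_measure L) angle_measure"
    unfolding config_measure_def using assms by (rule measurable_component_singleton)
  moreover have "(\<lambda>x. x) \<in> borel_measurable angle_measure"
    by (rule measurable_restrict_space1) simp
  ultimately show ?thesis by (rule measurable_compose)
qed

lemma hamiltonian_measurable [measurable]: "hamiltonian J L \<in> borel_measurable (config_measure L)"
proof -
  have [measurable]: "(\<lambda>\<theta>. \<theta> (shift L g r)) \<in> borel_measurable (config_measure L)" if "r \<in> sites L" for g r
    using shift_in_sites[OF that] by measurable
  show ?thesis unfolding hamiltonian_def by measurable
qed

lemma chi_tilde_measurable [measurable]: "chi_tilde D a L ts \<in> borel_measurable (config_measure L)"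
  unfolding chi_tilde_def close_mod_def by measurable

text \<open>Where the indicator is 1, the energy estimate bounds the integrand by a constant times a
  Gaussian in the centred displacements; elsewhere the integrand is 0. The restriction to small
  displacements thus serves only this pointwise bound.\<close>

lemma nn_integral_config_le:
  fixes ts :: real
  assumes J: "J > 0" and \<beta>: "\<beta> > 0" and D: "0 < D" "D < 1" and \<eta>: "0 < \<eta>"
    and L: "L = 2 * n" and a: "a \<in> {1,2,3::nat}"
    and e: "bij_betw e {..<L ^ 3} (sites L)"
  defines "d \<equiv> Determinant.det (Matrix.mat (L ^ 3) (L ^ 3) (\<lambda>(i,j). spin_wave_matrix a L ts \<eta> (e i) (e j)))"
  shows "0 < d" and
    "(\<integral>\<^sup>+ \<theta>. ennreal (exp (- \<beta> * hamiltonian J L \<theta>) * chi_tilde D a L ts \<theta>) \<partial>config_measure L) \<le>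
    ennreal (exp (\<beta> * J / 2 * ((24 * D ^ 3 + \<eta> * D\<^sup>2) * real L ^ 3)) *
      sqrt ((2 * pi / (\<beta> * J)) ^ (L ^ 3) / d))"
proof -
  let ?b = "\<lambda>r. sublattice_angle a ts (even (coord a r))"
  let ?x = "\<lambda>\<theta>. \<lambda>r\<in>sites L. centred (?b r) (\<theta> r)"
  let ?E = "(24 * D ^ 3 + \<eta> * D\<^sup>2) * real L ^ 3"
  define C where "C = exp (\<beta> * J / 2 * ?E)"
  define G where "G x = ennreal C * ennreal (exp (- (\<beta> * J) / 2 * spin_wave_form a L ts \<eta> x))" for x
  have meas_form: "spin_wave_form a L ts \<eta> \<in> borel_measurable (PiM (sites L) (\<lambda>_. lborel))"
  proof -
    have comp: "(\<lambda>x. x r) \<in> borel_measurable (PiM (sites L) (\<lambda>_. lborel))" if "r \<in> sites L" for r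
      using measurable_component_singleton[OF that, of "\<lambda>_. lborel"] by simp
    show ?thesis
      unfolding spin_wave_form_def[abs_def]
      by (intro borel_measurable_sum borel_measurable_add borel_measurable_times
          borel_measurable_power borel_measurable_const comp shift_in_sites)
  qed
  have inj: "inj_on e {..<L ^ 3}" and img: "e ` {..<L ^ 3} = sites L"
    using e by (auto simp: bij_betw_def)
  have gauss: "0 < d \<and>
    (\<integral>\<^sup>+ x. ennreal (exp (- (\<beta> * J) / 2 * (\<Sum>i<L ^ 3. \<Sum>j<L ^ 3. spin_wave_matrix a L ts \<eta> (e i) (e j) * x (e i) * x (e j))))
      \<partial>PiM (e ` {..<L ^ 3}) (\<lambda>_. lborel)) = ennreal (sqrt ((2 * pi / (\<beta> * J)) ^ (L ^ 3) / d))"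
    unfolding d_def
    by (rule nn_integral_gaussian[OF _ pos_def_spin_wave_matrix[OF e \<eta>] _ inj])
       (use J \<beta> in \<open>auto simp: spin_wave_matrix_def bond_matrix_sym\<close>)
  then show "0 < d" by simp
  have bound: "ennreal (exp (- \<beta> * hamiltonian J L \<theta>) * chi_tilde D a L ts \<theta>) \<le> G (?x \<theta>)" for \<theta>
  proof (cases "chi_tilde D a L ts \<theta> = 1")
    case True
    then have chi: "\<forall>r\<in>sites L. (even (coord a r) \<longrightarrow> close_mod D (\<theta> r) ts)
                    \<and> (odd (coord a r) \<longrightarrow> close_mod D (\<theta> r) (2 * phi a - ts))"
      unfolding chi_tilde_def by (auto split: if_splits)
    have close: "close_mod D (\<theta> r) (?b r)" if "r \<in> sites L" for r
      using chi that by (auto simp: sublattice_angle_def)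
    have "J / 2 * (spin_wave_form a L ts \<eta> (?x \<theta>) - ?E) \<le> hamiltonian J L \<theta>"
    proof (rule hamiltonian_lower_bound)
      fix r assume r: "r \<in> sites L"
      show "\<bar>?x \<theta> r\<bar> \<le> D" using centred_close[OF close[OF r] D(2)] r by simp
    next
      fix r g assume r: "r \<in> sites L"
      show "cos (\<theta> r - phi g) = cos (?b r + ?x \<theta> r - phi g)" using r by (simp add: cos_centred)
    qed (use J L a D \<eta> in auto)
    then have "\<beta> * (J / 2 * (spin_wave_form a L ts \<eta> (?x \<theta>) - ?E)) \<le> \<beta> * hamiltonian J L \<theta>"
      using \<beta> by (intro mult_left_mono) auto
    then have "- \<beta> * hamiltonian J L \<theta> \<le> \<beta> * J / 2 * ?E + - (\<beta> * J) / 2 * spin_wave_form a L ts \<eta> (?x \<theta>)"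
      by (simp add: right_diff_distrib mult.assoc)
    then have "exp (- \<beta> * hamiltonian J L \<theta>) \<le> C * exp (- (\<beta> * J) / 2 * spin_wave_form a L ts \<eta> (?x \<theta>))"
      unfolding C_def exp_add[symmetric] by (subst exp_le_cancel_iff)
    then show ?thesis
      using True unfolding G_def C_def by (simp add: ennreal_leI flip: ennreal_mult)
  next
    case False
    then have "chi_tilde D a L ts \<theta> = 0" by (auto simp: chi_tilde_def split: if_splits)
    then show ?thesis by simp
  qed
  have "(\<integral>\<^sup>+ \<theta>. ennreal (exp (- \<beta> * hamiltonian J L \<theta>) * chi_tilde D a L ts \<theta>) \<partial>config_measure L) \<le>
      (\<integral>\<^sup>+ \<theta>. G (?x \<theta>) \<partial>PiM (sites L) (\<lambda>_. angle_measure))"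
    unfolding config_measure_def by (intro nn_integral_mono bound)
  also have "\<dots> \<le> (\<integral>\<^sup>+ x. G x \<partial>PiM (sites L) (\<lambda>_. lborel))"
    by (rule nn_integral_PiM_centred_le) (use meas_form in \<open>simp_all add: G_def\<close>)
  also have "\<dots> = ennreal C * (\<integral>\<^sup>+ x. ennreal (exp (- (\<beta> * J) / 2 * spin_wave_form a L ts \<eta> x)) \<partial>PiM (sites L) (\<lambda>_. lborel))"
    unfolding G_def using meas_form by (intro nn_integral_cmult) simp
  also have "(\<integral>\<^sup>+ x. ennreal (exp (- (\<beta> * J) / 2 * spin_wave_form a L ts \<eta> x)) \<partial>PiM (sites L) (\<lambda>_. lborel)) =
      ennreal (sqrt ((2 * pi / (\<beta> * J)) ^ (L ^ 3) / d))"
    using gauss unfolding img spin_wave_matrix_form[OF e] by simp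
  also have "ennreal C * \<dots> = ennreal (C * sqrt ((2 * pi / (\<beta> * J)) ^ (L ^ 3) / d))"
    by (simp add: C_def ennreal_mult')
  finally show "(\<integral>\<^sup>+ \<theta>. ennreal (exp (- \<beta> * hamiltonian J L \<theta>) * chi_tilde D a L ts \<theta>) \<partial>config_measure L) \<le>
    ennreal (exp (\<beta> * J / 2 * ?E) * sqrt ((2 * pi / (\<beta> * J)) ^ (L ^ 3) / d))"
    unfolding C_def .
qed

lemma emeasure_close_mod_pos:
  assumes D: "0 < D"
  shows "{x \<in> {0..<2 * pi}. close_mod D x b} \<in> sets angle_measure"
    and "0 < emeasure angle_measure {x \<in> {0..<2 * pi}. close_mod D x b}"
proof -
  let ?S = "{x \<in> {0..<2 * pi}. close_mod D x b}"
  have "{x. close_mod D x b} \<in> sets borel"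
    unfolding close_mod_def by measurable
  then have "{0..<2 * pi} \<inter> {x. close_mod D x b} \<in> sets borel" by simp
  then have S: "?S \<in> sets borel" by (simp add: Int_def)
  then show "?S \<in> sets angle_measure" by (auto simp: sets_restrict_space_iff)
  define k where "k = \<lfloor>b / (2 * pi)\<rfloor>"
  define c where "c = b - 2 * pi * of_int k"
  have "of_int k \<le> b / (2 * pi)" "b / (2 * pi) < of_int k + 1"
    unfolding k_def by linarith+
  then have c: "0 \<le> c" "c < 2 * pi" by (simp_all add: c_def field_simps)
  \<comment> \<open>With \<open>c\<close> the representative of \<open>b\<close> in the period, an
    interval to its right suffices; cutting it off at 2 pi avoids any wrapping around.\<close>
  have "0 < emeasure lborel {c..<min (c + D) (2 * pi)}" using c D by simp
  also have "\<dots> \<le> emeasure lborel ?S"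
  proof (rule emeasure_mono)
    show "{c..<min (c + D) (2 * pi)} \<subseteq> ?S"
    proof
      fix x assume x: "x \<in> {c..<min (c + D) (2 * pi)}"
      then have "\<bar>x - b - 2 * pi * of_int (- k)\<bar> < D" by (auto simp: c_def)
      then show "x \<in> ?S" using x c unfolding close_mod_def by (auto intro: exI[of _ "- k"])
    qed
  qed (use S in simp)
  also have "\<dots> = emeasure angle_measure ?S"
    by (rule emeasure_restrict_space[symmetric]) (use S in auto)
  finally show "0 < emeasure angle_measure ?S" .
qed

text \<open>The indicator is 1 on a product of sets of positive measure and the exponential is
  positive. Strict positivity is what permits taking logarithms of the upper bound.\<close>

lemma nn_integral_config_pos:
  assumes D: "0 < D"
  shows "0 < (\<integral>\<^sup>+ \<theta>. ennreal (exp (- \<beta> * hamiltonian J L \<theta>) * chi_tilde D a L ts \<theta>) \<partial>config_measure L)"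
proof (rule ccontr)
  assume "\<not> ?thesis"
  then have "AE \<theta> in config_measure L. ennreal (exp (- \<beta> * hamiltonian J L \<theta>) * chi_tilde D a L ts \<theta>) = 0"
    by (subst (asm) not_less, subst nn_integral_0_iff_AE[symmetric]) auto
  then have ae: "AE \<theta> in config_measure L. chi_tilde D a L ts \<theta> = 0"
    by eventually_elim (auto simp: chi_tilde_def split: if_splits)
  let ?b = "\<lambda>r. sublattice_angle a ts (even (coord a r))"
  let ?S = "\<lambda>r. {x \<in> {0..<2 * pi}. close_mod D x (?b r)}"
  have sets: "?S r \<in> sets angle_measure" for r using emeasure_close_mod_pos(1)[OF D] .
  have one: "chi_tilde D a L ts \<theta> = 1" if "\<theta> \<in> (\<Pi>\<^sub>E r\<in>sites L. ?S r)" for \<theta>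
  proof -
    have "close_mod D (\<theta> r) (?b r)" if "r \<in> sites L" for r
      using \<open>\<theta> \<in> _\<close> that by (auto simp: PiE_iff)
    then have "\<forall>r\<in>sites L. (even (coord a r) \<longrightarrow> close_mod D (\<theta> r) ts)
        \<and> (odd (coord a r) \<longrightarrow> close_mod D (\<theta> r) (2 * phi a - ts))"
      unfolding sublattice_angle_def by metis
    then show ?thesis by (simp add: chi_tilde_def)
  qed
  have "emeasure (config_measure L) (\<Pi>\<^sub>E r\<in>sites L. ?S r) = 0"
  proof -
    have "(\<Pi>\<^sub>E r\<in>sites L. ?S r) \<in> sets (config_measure L)"
      unfolding config_measure_def using sets by (intro sets_PiM_I_finite) auto
    moreover have "AE \<theta> in config_measure L. \<theta> \<notin> (\<Pi>\<^sub>E r\<in>sites L. ?S r)"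
      using ae by eventually_elim (use one in auto)
    ultimately show ?thesis using AE_iff_null_sets null_setsD1 by blast
  qed
  moreover have "emeasure (config_measure L) (\<Pi>\<^sub>E r\<in>sites L. ?S r) = (\<Prod>r\<in>sites L. emeasure angle_measure (?S r))"
    unfolding config_measure_def by (rule angle_product.emeasure_PiM) (use sets in auto)
  ultimately have "\<exists>r\<in>sites L. emeasure angle_measure (?S r) = 0"
    by (simp add: prod_zero_iff)
  then show False using emeasure_close_mod_pos(2)[OF D] by (metis less_irrefl)
qed

text \<open>The factor 1/4 has two sources: the square root in the Gaussian integral and the halving
  of the momenta. The powers of 2 pi / (\<beta> J) cancel against the normalising logarithm in the
  free energy.\<close>

lemma F_tilde_L_lower_bound:
  assumes J: "J > 0" and \<beta>: "\<beta> > 0" and D: "0 < D" "D < 1" and \<eta>: "0 < \<eta>"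
    and L: "L = 2 * n" "n > 0" and a: "a \<in> {1,2,3::nat}"
  shows "(\<Sum>k\<in>sites L. ln (\<eta>\<^sup>2 + det_Pi a ts (momentum_vec L k))) / (4 * real L ^ 3)
    - (12 * (\<beta> * J * D ^ 3) + \<beta> * J * \<eta> * D\<^sup>2 / 2) \<le> F_tilde_L J \<beta> D a L ts"
proof -
  have "\<exists>e. bij_betw e {..<L ^ 3} (sites L)"
    using ex_bij_betw_nat_finite[OF finite_sites, of L] by (simp add: card_sites atLeast0LessThan)
  then obtain e where e: "bij_betw e {..<L ^ 3} (sites L)" by blast
  define d where "d = Determinant.det (Matrix.mat (L ^ 3) (L ^ 3) (\<lambda>(i,j). spin_wave_matrix a L ts \<eta> (e i) (e j)))"
  define E where "E = 24 * D ^ 3 + \<eta> * D\<^sup>2"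
  define N where "N = real L ^ 3"
  define p where "p = 2 * pi / (\<beta> * J)"
  let ?h = "\<lambda>\<theta>. exp (- \<beta> * hamiltonian J L \<theta>) * chi_tilde D a L ts \<theta>"
  define Z where "Z = integral\<^sup>L (config_measure L) ?h"
  define I where "I = (\<integral>\<^sup>+ \<theta>. ennreal (?h \<theta>) \<partial>config_measure L)"
  note bound = nn_integral_config_le[OF J \<beta> D \<eta> L(1) a e, of ts, folded d_def E_def N_def p_def I_def]
  have N0: "N > 0" using L by (simp add: N_def)
  have p0: "p > 0" using J \<beta> by (simp add: p_def)
  have ZI: "Z = enn2real I"
    unfolding Z_def I_def
  proof (rule integral_eq_nn_integral)
    show "AE \<theta> in config_measure L. 0 \<le> ?h \<theta>" by (simp add: chi_tilde_def)
  qed measurable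
  have "I < \<infinity>" using bound(2) by (rule le_less_trans) simp
  then have Z0: "Z > 0"
    unfolding ZI using nn_integral_config_pos[OF D(1), where L = L and \<beta> = \<beta> and J = J and a = a and ts = ts, folded I_def]
    by (simp add: enn2real_positive_iff)
  have "Z \<le> exp (\<beta> * J / 2 * (E * N)) * sqrt (p ^ (L ^ 3) / d)"
    unfolding ZI using enn2real_mono[OF bound(2)] bound(1) p0 by simp
  then have "ln Z \<le> ln (exp (\<beta> * J / 2 * (E * N)) * sqrt (p ^ (L ^ 3) / d))"
    using Z0 by (subst ln_le_cancel_iff) auto
  also have "\<dots> = \<beta> * J / 2 * (E * N) + (N * ln p - ln d) / 2"
    using p0 bound(1) by (simp add: ln_mult ln_sqrt ln_div ln_realpow N_def)
  also have "\<dots> \<le> \<beta> * J / 2 * (E * N) +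
      (N * ln p - (\<Sum>k\<in>sites L. ln (\<eta>\<^sup>2 + det_Pi a ts (momentum_vec L k))) / 2) / 2"
  proof -
    have "(\<Sum>k\<in>sites L. ln (\<eta>\<^sup>2 + det_Pi a ts (momentum_vec L k))) / 2 \<le> ln d"
      using ln_det_spin_wave_matrix_ge[OF L a \<eta> e, of ts] by (simp add: d_def)
    then show ?thesis by (intro add_left_mono divide_right_mono diff_left_mono) auto
  qed
  finally have lnZ: "ln Z \<le> \<beta> * J / 2 * (E * N) +
      (N * ln p - (\<Sum>k\<in>sites L. ln (\<eta>\<^sup>2 + det_Pi a ts (momentum_vec L k))) / 2) / 2" .
  have "ln Z / N \<le> (\<beta> * J / 2 * (E * N) +
      (N * ln p - (\<Sum>k\<in>sites L. ln (\<eta>\<^sup>2 + det_Pi a ts (momentum_vec L k))) / 2) / 2) / N"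
    using lnZ N0 by (intro divide_right_mono) auto
  also have "\<dots> = \<beta> * J / 2 * E + ln p / 2 - (\<Sum>k\<in>sites L. ln (\<eta>\<^sup>2 + det_Pi a ts (momentum_vec L k))) / (4 * N)"
    using N0 by (simp add: field_simps)
  finally have "ln Z / N \<le> \<beta> * J / 2 * E + ln p / 2 -
      (\<Sum>k\<in>sites L. ln (\<eta>\<^sup>2 + det_Pi a ts (momentum_vec L k))) / (4 * N)" .
  moreover have "ln (\<beta> * J / (2 * pi)) = - ln p"
    using J \<beta> by (simp add: p_def ln_div)
  moreover have "F_tilde_L J \<beta> D a L ts = - 1 / 2 * ln (\<beta> * J / (2 * pi)) - ln Z / N"
    by (simp add: F_tilde_L_def Z_def N_def)
  moreover have "\<beta> * J / 2 * E = 12 * (\<beta> * J * D ^ 3) + \<beta> * J * \<eta> * D\<^sup>2 / 2"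
    by (simp add: E_def algebra_simps)
  ultimately show ?thesis unfolding N_def by linarith
qed

theorem theorem4p5:
  fixes J :: real
  assumes "J > 0"
  shows "\<forall>\<epsilon>>0. \<exists>\<delta>>0. \<forall>\<beta> D. \<beta> > 0 \<and> 0 < D \<and> D < 1 \<and> \<beta> * J * D ^ 3 \<le> \<delta> \<longrightarrow>
           (\<forall>ts\<in>{0..<2 * pi}. \<forall>a\<in>{1,2,3::nat}.
              liminf (\<lambda>n. ereal (F_tilde_L J \<beta> D a (2 * n) ts))
                \<ge> ereal (F_tilde a ts - \<epsilon>))"
proof (intro allI impI)
  fix \<epsilon> :: real assume \<epsilon>: "\<epsilon> > 0"
  show "\<exists>\<delta>>0. \<forall>\<beta> D. \<beta> > 0 \<and> 0 < D \<and> D < 1 \<and> \<beta> * J * D ^ 3 \<le> \<delta> \<longrightarrow>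
           (\<forall>ts\<in>{0..<2 * pi}. \<forall>a\<in>{1,2,3::nat}.
              liminf (\<lambda>n. ereal (F_tilde_L J \<beta> D a (2 * n) ts))
                \<ge> ereal (F_tilde a ts - \<epsilon>))"
  \<comment> \<open>The error \<epsilon> is shared equally by the cubic Taylor term, with 12
    \<epsilon> / 36 = \<epsilon> / 3, the mass term and the Riemann sum.\<close>
  proof (intro exI[of _ "\<epsilon> / 36"] conjI allI impI ballI)
    show "\<epsilon> / 36 > 0" using \<epsilon> by simp
  next
    fix \<beta> D ts :: real and a :: nat
    assume "\<beta> > 0 \<and> 0 < D \<and> D < 1 \<and> \<beta> * J * D ^ 3 \<le> \<epsilon> / 36" and a: "a \<in> {1,2,3}"
    then have \<beta>: "\<beta> > 0" and D: "0 < D" "D < 1" and small: "\<beta> * J * D ^ 3 \<le> \<epsilon> / 36" by auto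
    \<comment> \<open>This makes \<beta> J \<eta> = \<epsilon> / 3, so the mass costs little
      whatever \<beta> is. It is independent of L, as the convergence of the Riemann sums
      requires.\<close>
    define \<eta> where "\<eta> = \<epsilon> / (3 * (\<beta> * J))"
    have \<eta>: "\<eta> > 0" using \<epsilon> \<beta> assms by (simp add: \<eta>_def)
    have "\<beta> * J * \<eta> * D\<^sup>2 / 2 \<le> \<epsilon> / 3"
    proof -
      have "\<beta> * J * \<eta> = \<epsilon> / 3" using \<beta> assms by (simp add: \<eta>_def)
      moreover have "\<epsilon> / 3 * D\<^sup>2 \<le> \<epsilon> / 3 * 1"
        using \<epsilon> D by (intro mult_left_mono power_le_one) auto
      ultimately have "\<beta> * J * \<eta> * D\<^sup>2 \<le> \<epsilon> / 3" by (simp only: mult_1_right)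
      then show ?thesis using \<epsilon> by linarith
    qed
    then have err: "12 * (\<beta> * J * D ^ 3) + \<beta> * J * \<eta> * D\<^sup>2 / 2 \<le> 2 * \<epsilon> / 3"
      using small by linarith
    have "\<forall>\<^sub>F n in sequentially. F_tilde a ts \<le>
        (\<Sum>k\<in>sites (2 * n). ln (\<eta>\<^sup>2 + det_Pi a ts (momentum_vec (2 * n) k))) / (4 * real (2 * n) ^ 3) + \<epsilon> / 3"
      using F_tilde_le_riemann_sum[OF a \<eta>, of "\<epsilon> / 3" ts] \<epsilon>
      by (intro eventually_compose_filterlim[OF _ mult_nat_left_at_top]) auto
    then have "\<forall>\<^sub>F n in sequentially. ereal (F_tilde a ts - \<epsilon>) \<le> ereal (F_tilde_L J \<beta> D a (2 * n) ts)"
      using eventually_gt_at_top[of 0]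
    proof eventually_elim
      case (elim n)
      then show ?case
        using F_tilde_L_lower_bound[OF assms \<beta> D \<eta> refl elim(2) a, of ts] err by simp
    qed
    then show "ereal (F_tilde a ts - \<epsilon>) \<le> liminf (\<lambda>n. ereal (F_tilde_L J \<beta> D a (2 * n) ts))"
      by (rule Liminf_bounded)
  qed
qed

end
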